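(* Let $t_0>0$, $\alpha>0$, $\delta>0$, $\sigma\ge0$, $\mu>0$, $r\in(0,1)$, $s\in[r,1)$, $\tau\in(0,r+s)$, and assume $\alpha\delta>1$ if $s=r$. Let $$\beta(t)=\mu\,\frac{e^{\frac1{\delta(1-s)}t^{1-s}}}{t^\tau},$$ and let $\epsilon:[t_0,+\infty)\to\mathcal H_1$ satisfy $\int_{t_0}^{+\infty}t^{\tau/2}\|\epsilon(t)\|\,dt<+\infty$. Let $(x(t),\lambda(t))$ be a global solution on $[t_0,+\infty)$ of $$\begin{cases}\ddot x(t)+\frac{\alpha}{t^r}\dot x(t)=-\beta(t)\big(\nabla f(x(t))+A^T(\lambda(t)+\delta t^s\dot\lambda(t))+\sigma A^T(Ax(t)-b)\big)+\epsilon(t),\\ \ddot\lambda(t)+\frac{\alpha}{t^r}\dot\lambda(t)=\beta(t)\big(A(x(t)+\delta t^s\dot x(t))-b\big),\end{cases}$$ and let $(x^*,\lambda^* )\in\Omega$. Then $$|f(x(t))-f(x^* )|=\mathcal O\left(\frac1{e^{\frac1{\delta(1-s)}t^{1-s}}}\right),\qquad \|Ax(t)-b\|=\mathcal O\left(\frac1{e^{\frac1{\delta(1-s)}t^{1-s}}}\right).$$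
   Context: $\mathcal H_1,\mathcal H_2$ are real Hilbert spaces, $A:\mathcal H_1\to\mathcal H_2$ is a continuous linear operator with adjoint $A^T$, $b\in\mathcal H_2$, and $f:\mathcal H_1\to\mathbb R$ is convex and continuously differentiable. $\Omega\subset\mathcal H_1\times\mathcal H_2$ is the set of saddle points of the Lagrangian $\mathcal L(x,\lambda)=f(x)+\langle\lambda,Ax-b\rangle$, equivalently the set of pairs $(x^*,\lambda^* )$ with $\nabla f(x^* )=-A^T\lambda^*$ and $Ax^*=b$; it is assumed nonempty. A global solution of the system is a pair $(x,\lambda)$ with $x\in\mathcal C^2([t_0,+\infty),\mathcal H_1)$, $\lambda\in\mathcal C^2([t_0,+\infty),\mathcal H_2)$, such that $(x,\lambda)$ and $(\dot x,\dot\lambda)$ are locally absolutely continuous and the system holds for almost every $t\ge t_0$. All $\mathcal O(\cdot)$ are as $t\to+\infty$. *)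

theory Defs
  imports "HOL-Analysis.Analysis" "HOL-Library.Landau_Symbols"
begin

text \<open>
  Real Hilbert spaces are types of sort \<open>{real_inner, complete_space}\<close>. By the Riesz
  representation theorem, on such types a bounded linear operator has an adjoint and a Frechet
  differentiable real function has a gradient, so the choice and description operators in the
  library's \<open>adjoint\<close> and in \<open>gradient\<close> below denote the intended objects.
\<close>

definition gradient :: "('a::real_inner \<Rightarrow> real) \<Rightarrow> 'a \<Rightarrow> 'a" where
  "gradient f x = (THE D. GDERIV f x :> D)"

text \<open>Continuity of the derivative is with respect to the operator norm.\<close>

definition continuously_differentiable :: "('a::real_normed_vector \<Rightarrow> real) \<Rightarrow> bool" where
  "continuously_differentiable f \<longleftrightarrow>
     (\<exists>f' :: 'a \<Rightarrow> ('a \<Rightarrow>\<^sub>L real).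
        (\<forall>x. (f has_derivative blinfun_apply (f' x)) (at x)) \<and> continuous_on UNIV f')"

definition lagrangian ::
  "('a::real_inner \<Rightarrow> real) \<Rightarrow> ('a \<Rightarrow> 'b::real_inner) \<Rightarrow> 'b \<Rightarrow> 'a \<Rightarrow> 'b \<Rightarrow> real" where
  "lagrangian f A b x l = f x + l \<bullet> (A x - b)"

definition saddle_points ::
  "('a::real_inner \<Rightarrow> real) \<Rightarrow> ('a \<Rightarrow> 'b::real_inner) \<Rightarrow> 'b \<Rightarrow> ('a \<times> 'b) set" where
  "saddle_points f A b =
     {(xs, ls). \<forall>x l. lagrangian f A b xs l \<le> lagrangian f A b xs ls \<and>
                      lagrangian f A b xs ls \<le> lagrangian f A b x ls}"

text \<open>
  Derivatives of curves are taken relative to the domain \<open>S\<close>; for \<open>S = {t0..}\<close> this is the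
  right derivative at \<open>t0\<close> and the ordinary derivative elsewhere, and values of a curve
  outside \<open>S\<close> are irrelevant.
\<close>

definition deriv_on :: "real set \<Rightarrow> (real \<Rightarrow> 'a::real_normed_vector) \<Rightarrow> real \<Rightarrow> 'a" where
  "deriv_on S u t = vector_derivative u (at t within S)"

definition C2_on :: "real set \<Rightarrow> (real \<Rightarrow> 'a::real_normed_vector) \<Rightarrow> bool" where
  "C2_on S u \<longleftrightarrow> u differentiable_on S \<and> deriv_on S u differentiable_on S \<and>
     continuous_on S (deriv_on S (deriv_on S u))"

text \<open>
  A pair \<open>(c, d)\<close> in \<open>I\<close> encodes the interval from \<open>c\<close> to \<open>d\<close>; the intervals are
  non-overlapping, i.e. their interiors are disjoint.
\<close>

definition absolutely_continuous_on_interval ::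
  "real \<Rightarrow> real \<Rightarrow> (real \<Rightarrow> 'a::real_normed_vector) \<Rightarrow> bool" where
  "absolutely_continuous_on_interval a b u \<longleftrightarrow>
     (\<forall>e>0. \<exists>\<eta>>0. \<forall>I :: (real \<times> real) set.
        finite I \<and> (\<forall>(c, d)\<in>I. a \<le> c \<and> c \<le> d \<and> d \<le> b) \<and>
        disjoint_family_on (\<lambda>(c, d). {c<..<d}) I \<and> (\<Sum>(c, d)\<in>I. d - c) < \<eta> \<longrightarrow>
        (\<Sum>(c, d)\<in>I. norm (u d - u c)) < e)"

definition locally_absolutely_continuous_from ::
  "real \<Rightarrow> (real \<Rightarrow> 'a::real_normed_vector) \<Rightarrow> bool" where
  "locally_absolutely_continuous_from t0 u \<longleftrightarrow>
     (\<forall>a b. t0 \<le> a \<and> a \<le> b \<longrightarrow> absolutely_continuous_on_interval a b u)"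

definition exp_rate :: "real \<Rightarrow> real \<Rightarrow> real \<Rightarrow> real" where
  "exp_rate \<delta> s t = exp (1 / (\<delta> * (1 - s)) * t powr (1 - s))"

definition scaling :: "real \<Rightarrow> real \<Rightarrow> real \<Rightarrow> real \<Rightarrow> real \<Rightarrow> real" where
  "scaling \<mu> \<delta> s \<tau> t = \<mu> * (exp_rate \<delta> s t / t powr \<tau>)"

definition global_solution ::
  "('a::real_inner \<Rightarrow> real) \<Rightarrow> ('a \<Rightarrow> 'b::real_inner) \<Rightarrow> 'b \<Rightarrow>
   real \<Rightarrow> real \<Rightarrow> real \<Rightarrow> real \<Rightarrow> real \<Rightarrow> (real \<Rightarrow> real) \<Rightarrow> (real \<Rightarrow> 'a) \<Rightarrow>
   real \<Rightarrow> (real \<Rightarrow> 'a) \<Rightarrow> (real \<Rightarrow> 'b) \<Rightarrow> bool" where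
  "global_solution f A b \<alpha> \<delta> \<sigma> r s \<beta> \<epsilon> t0 x l \<longleftrightarrow>
     C2_on {t0..} x \<and> C2_on {t0..} l \<and>
     locally_absolutely_continuous_from t0 (\<lambda>t. (x t, l t)) \<and>
     locally_absolutely_continuous_from t0 (\<lambda>t. (deriv_on {t0..} x t, deriv_on {t0..} l t)) \<and>
     (AE t in lebesgue. t \<ge> t0 \<longrightarrow>
        deriv_on {t0..} (deriv_on {t0..} x) t + (\<alpha> / t powr r) *\<^sub>R deriv_on {t0..} x t =
          - (\<beta> t *\<^sub>R (gradient f (x t)
               + adjoint A (l t + (\<delta> * t powr s) *\<^sub>R deriv_on {t0..} l t)
               + \<sigma> *\<^sub>R adjoint A (A (x t) - b))) + \<epsilon> t \<and>
        deriv_on {t0..} (deriv_on {t0..} l) t + (\<alpha> / t powr r) *\<^sub>R deriv_on {t0..} l t =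
          \<beta> t *\<^sub>R (A (x t + (\<delta> * t powr s) *\<^sub>R deriv_on {t0..} x t) - b))"

end

theory Submission
  imports Defs
begin

text \<open>
  Write \<open>g = exp_rate \<delta> s\<close> and \<open>\<gamma>(t) = \<delta> t\<^sup>s\<close>, so that \<open>g' = g / \<gamma>\<close>; let \<open>F\<close> be the gap of the
  augmented Lagrangian at \<open>\<lambda>\<^sup>*\<close> and put \<open>v = x - x\<^sup>* + \<gamma> x'\<close>, \<open>w = \<lambda> - \<lambda>\<^sup>* + \<gamma> \<lambda>'\<close>. Testing the
  system with \<open>(v, w)\<close> cancels the coupling through \<open>A\<close>. Hence the energy
  \<open>t powr (\<tau> - 2 s) (|v|\<^sup>2 + |w|\<^sup>2) / 2 + P(t) (|x - x\<^sup>*|\<^sup>2 + |\<lambda> - \<lambda>\<^sup>*|\<^sup>2) / 2 + \<delta>\<^sup>2 \<mu> g F(x)\<close> has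
  derivative at most \<open>\<delta> t powr (\<tau> / 2) |\<epsilon>| sqrt (2 energy)\<close> for large \<open>t\<close>, so it is bounded and
  \<open>F(x) = O(1 / g)\<close>. This alone would give only the square root of the rate for \<open>A x - b\<close>, but
  the dual equation expresses \<open>(g (A x - b))'\<close> through \<open>\<lambda>'\<close> and \<open>\<lambda>''\<close>, and the energy bounds on
  \<open>\<lambda>\<close> and \<open>\<lambda>'\<close> make its integral bounded.
\<close>

subsection \<open>Adjoints and gradients in Hilbert spaces\<close>

text \<open>The representing vector is the minimizer of the quadratic functional \<open>J\<close>:
  completeness makes a minimizing sequence converge, and the first variation at the limit must
  vanish.\<close>

lemma riesz_representation:
  fixes \<phi> :: "'a::{real_inner, complete_space} \<Rightarrow> real"
  assumes "bounded_linear \<phi>"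
  obtains D where "\<And>h. \<phi> h = h \<bullet> D"
proof -
  interpret \<phi>: bounded_linear \<phi> by fact
  define J where "J u = u \<bullet> u - 2 * \<phi> u" for u
  obtain K where K: "\<And>u. norm (\<phi> u) \<le> norm u * K"
    using \<phi>.bounded by blast
  have lower: "J u \<ge> - (K * K)" for u
  proof -
    have "\<phi> u \<le> norm u * K" using K[of u] by simp
    moreover have "0 \<le> (norm u - K) * (norm u - K)" by simp
    ultimately show ?thesis
      by (simp add: J_def power2_norm_eq_inner[symmetric] power2_eq_square algebra_simps)
  qed
  define m where "m = Inf (range J)"
  have bdd: "bdd_below (range J)" using lower by (auto intro!: bdd_belowI)
  have m_le: "m \<le> J u" for u unfolding m_def by (rule cINF_lower[OF bdd]) simp
  have "\<exists>u. J u < m + inverse (real (Suc n))" for n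
    using cINF_less_iff[OF _ bdd, of "m + inverse (real (Suc n))"] by (auto simp: m_def)
  then obtain X where X: "\<And>n. J (X n) < m + inverse (real (Suc n))" by metis
  \<comment> \<open>Parallelogram law: the linear part of \<open>J\<close> cancels, so a minimizing sequence is Cauchy.\<close>
  have par: "(norm (u - v))\<^sup>2 \<le> 2 * (J u - m) + 2 * (J v - m)" for u v
  proof -
    have "(norm (u - v))\<^sup>2 = 2 * J u + 2 * J v - 4 * J ((1/2) *\<^sub>R (u + v))"
      by (simp add: J_def power2_norm_eq_inner inner_simps \<phi>.scaleR \<phi>.add inner_commute algebra_simps)
    with m_le[of "(1/2) *\<^sub>R (u + v)"] show ?thesis by simp
  qed
  have "Cauchy X"
  proof (rule metric_CauchyI)
    fix e :: real assume "e > 0"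
    then obtain N where N: "inverse (real (Suc N)) < e\<^sup>2 / 4"
      using reals_Archimedean[of "e\<^sup>2 / 4"] by auto
    have small: "J (X n) - m < e\<^sup>2 / 4" if "n \<ge> N" for n
    proof -
      have "inverse (real (Suc n)) \<le> inverse (real (Suc N))" using that by (simp add: field_simps)
      with X[of n] N show ?thesis by linarith
    qed
    have "dist (X i) (X j) < e" if "i \<ge> N" "j \<ge> N" for i j
    proof -
      have "(norm (X i - X j))\<^sup>2 < e\<^sup>2"
        using par[of "X i" "X j"] small[OF that(1)] small[OF that(2)] by simp
      then show ?thesis using \<open>e > 0\<close> by (simp add: dist_norm power_less_imp_less_base)
    qed
    then show "\<exists>M. \<forall>i\<ge>M. \<forall>j\<ge>M. dist (X i) (X j) < e" by blast
  qed
  then obtain D where D: "X \<longlonglongrightarrow> D" using Cauchy_convergent convergent_def by blast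
  have "(\<lambda>n. J (X n)) \<longlonglongrightarrow> J D"
    unfolding J_def by (intro tendsto_intros D \<phi>.tendsto)
  moreover have "(\<lambda>n. m + inverse (real (Suc n))) \<longlonglongrightarrow> m + 0"
    by (intro tendsto_intros LIMSEQ_inverse_real_of_nat)
  ultimately have "J D \<le> m + 0"
    using X by (intro LIMSEQ_le) (auto intro: less_imp_le)
  then have D_min: "J D \<le> J u" for u using m_le[of u] by simp
  have "\<phi> h = h \<bullet> D" for h
  proof (rule ccontr)
    assume neq: "\<phi> h \<noteq> h \<bullet> D"
    define a where "a = \<phi> h - h \<bullet> D"
    \<comment> \<open>\<open>c\<close> minimizes
      \<open>- 2 * c * a + c * c * (1 + h \<bullet> h)\<close>; the summand 1 keeps the denominator
      positive for \<open>h = 0\<close>. Moving from \<open>D\<close> by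
      \<open>c *\<^sub>R h\<close> lowers \<open>J\<close> by at least
      \<open>c * a > 0\<close>.\<close>
    define c where "c = a / (1 + h \<bullet> h)"
    have pos: "1 + h \<bullet> h > 0" by (simp add: add_pos_nonneg)
    have "J (D + c *\<^sub>R h) = J D - 2 * c * a + c * c * (h \<bullet> h)"
      by (simp add: J_def a_def inner_simps \<phi>.scaleR \<phi>.add inner_commute algebra_simps)
    moreover have "c * c * (h \<bullet> h) \<le> c * c * (1 + h \<bullet> h)"
      by (intro mult_left_mono) auto
    moreover have "c * c * (1 + h \<bullet> h) = c * a" using pos by (simp add: c_def)
    moreover have "c * a > 0"
    proof -
      have "a * a > 0" using neq by (simp add: a_def less_le)
      then show ?thesis using pos by (simp add: c_def)
    qed
    ultimately show False using D_min[of "D + c *\<^sub>R h"] by simp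
  qed
  then show ?thesis using that by blast
qed

text \<open>Riesz applied to \<open>\<lambda>u. A u \<bullet> w\<close> for each \<open>w\<close>
  yields a map with the adjoint property, so the choice operator in \<open>adjoint\<close> selects
  one that has it.\<close>

lemma inner_adjoint:
  fixes A :: "'a::{real_inner, complete_space} \<Rightarrow> 'b::real_inner"
  assumes "bounded_linear A"
  shows "A u \<bullet> w = u \<bullet> adjoint A w"
proof -
  have "\<exists>v. \<forall>u. A u \<bullet> w = u \<bullet> v" for w
  proof -
    have "bounded_linear (\<lambda>u. A u \<bullet> w)"
      using assms bounded_linear_inner_left_comp by blast
    from riesz_representation[OF this] show ?thesis by metis
  qed
  then have "\<exists>B. \<forall>u w. A u \<bullet> w = u \<bullet> B w" by metis
  from someI_ex[OF this] show ?thesis unfolding adjoint_def by blast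
qed

text \<open>Linearity follows by testing against every vector. For the bound, test with
  \<open>adjoint A w\<close> itself and cancel one factor of its norm; the constant \<open>K\<close>
  of \<open>A\<close> carries over.\<close>

lemma bounded_linear_adjoint:
  fixes A :: "'a::{real_inner, complete_space} \<Rightarrow> 'b::real_inner"
  assumes "bounded_linear A"
  shows "bounded_linear (adjoint A)"
proof -
  note adj = inner_adjoint[OF assms]
  obtain K where "0 \<le> K" and K: "\<And>u. norm (A u) \<le> norm u * K"
    using bounded_linear.nonneg_bounded[OF assms] by blast
  show ?thesis
  proof (rule bounded_linear_intro[where K=K])
    fix u w
    have "v \<bullet> adjoint A (u + w) = v \<bullet> (adjoint A u + adjoint A w)" for v
      by (simp add: adj[symmetric] inner_simps)
    then show "adjoint A (u + w) = adjoint A u + adjoint A w"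
      by (rule vector_eq_ldot[THEN iffD1, rule_format])
  next
    fix c u
    have "v \<bullet> adjoint A (c *\<^sub>R u) = v \<bullet> (c *\<^sub>R adjoint A u)" for v
      by (simp add: adj[symmetric])
    then show "adjoint A (c *\<^sub>R u) = c *\<^sub>R adjoint A u"
      by (rule vector_eq_ldot[THEN iffD1, rule_format])
  next
    fix w
    let ?u = "adjoint A w"
    have "norm ?u * norm ?u = A ?u \<bullet> w"
      by (simp add: adj power2_norm_eq_inner[symmetric] power2_eq_square)
    also have "\<dots> \<le> norm (A ?u) * norm w" by (rule norm_cauchy_schwarz)
    also have "\<dots> \<le> norm ?u * K * norm w" by (intro mult_right_mono K) simp
    finally have "norm ?u * norm ?u \<le> norm ?u * (norm w * K)" by (simp add: mult_ac)
    then show "norm ?u \<le> norm w * K"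
      using \<open>0 \<le> K\<close> by (cases "?u = 0") auto
  qed
qed

text \<open>Riesz turns the derivative into an inner product, and the representing vector is unique
  because the derivative is, so the description operator in \<open>gradient\<close> is well
  defined.\<close>

lemma gderiv_gradient:
  fixes f :: "'a::{real_inner, complete_space} \<Rightarrow> real"
  assumes "(f has_derivative f') (at x)"
  shows "GDERIV f x :> gradient f x"
proof -
  obtain D where D: "\<And>h. f' h = h \<bullet> D"
    using riesz_representation has_derivative_bounded_linear[OF assms] by metis
  have "GDERIV f x :> D" using assms by (simp add: gderiv_def D[symmetric])
  moreover have "D' = D" if "GDERIV f x :> D'" for D'
  proof -
    have "(\<lambda>h. h \<bullet> D') = f'" using that assms has_derivative_unique
      unfolding gderiv_def by blast
    then have "h \<bullet> D' = h \<bullet> D" for h by (simp add: D[symmetric] fun_eq_iff)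
    then show ?thesis by (rule vector_eq_ldot[THEN iffD1, rule_format])
  qed
  ultimately show ?thesis unfolding gradient_def by (rule theI)
qed

text \<open>Continuity transfers from \<open>f'\<close>, since evaluating \<open>f' u - f' v\<close>
  at the difference of the two gradients gives the squared norm of that difference.\<close>

lemma continuously_differentiable_gradient:
  fixes f :: "'a::{real_inner, complete_space} \<Rightarrow> real"
  assumes "continuously_differentiable f"
  shows "GDERIV f x :> gradient f x" and "continuous_on UNIV (gradient f)"
proof -
  obtain f' :: "'a \<Rightarrow> ('a \<Rightarrow>\<^sub>L real)"
    where f': "\<And>x. (f has_derivative blinfun_apply (f' x)) (at x)" and cont: "continuous_on UNIV f'"
    using assms unfolding continuously_differentiable_def by blast
  show grad: "GDERIV f x :> gradient f x" for x by (rule gderiv_gradient[OF f'])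
  have app: "f' x h = h \<bullet> gradient f x" for x h
    using has_derivative_unique[OF f' grad[unfolded gderiv_def]] by metis
  have dist: "dist (gradient f u) (gradient f v) \<le> dist (f' u) (f' v)" for u v
  proof -
    let ?d = "gradient f u - gradient f v"
    have "norm ?d * norm ?d = ?d \<bullet> ?d"
      by (simp add: power2_norm_eq_inner[symmetric] power2_eq_square)
    also have "\<dots> = (f' u - f' v) ?d"
      by (simp add: blinfun.diff_left app inner_diff_right)
    also have "\<dots> \<le> norm (f' u - f' v) * norm ?d"
      using norm_blinfun[of "f' u - f' v" ?d] by simp
    finally show ?thesis by (cases "?d = 0") (auto simp: dist_norm)
  qed
  show "continuous_on UNIV (gradient f)"
    using cont dist unfolding continuous_on_iff by (meson le_less_trans)
qed

text \<open>Restriction to the line through \<open>u\<close> and \<open>v\<close> reduces this to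
  the tangent inequality in one variable.\<close>

lemma convex_on_above_tangent_gderiv:
  assumes "convex_on UNIV f" and "GDERIV f u :> D"
  shows "f v - f u \<ge> D \<bullet> (v - u)"
proof -
  define \<phi> where "\<phi> c = f (u + c *\<^sub>R (v - u))" for c :: real
  have "convex_on UNIV \<phi>"
  proof (rule convex_onI)
    fix c a d :: real assume c: "0 < c" "c < 1"
    have "u + ((1 - c) *\<^sub>R a + c *\<^sub>R d) *\<^sub>R (v - u)
        = (1 - c) *\<^sub>R (u + a *\<^sub>R (v - u)) + c *\<^sub>R (u + d *\<^sub>R (v - u))"
      by (simp add: algebra_simps)
    then show "\<phi> ((1 - c) *\<^sub>R a + c *\<^sub>R d) \<le> (1 - c) * \<phi> a + c * \<phi> d"
      unfolding \<phi>_def using convex_onD[OF assms(1), of c] c by auto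
  qed simp
  moreover have "(\<phi> has_field_derivative D \<bullet> (v - u)) (at 0)"
  proof -
    have line: "((\<lambda>c::real. u + c *\<^sub>R (v - u)) has_derivative (\<lambda>c. c *\<^sub>R (v - u))) (at 0)"
      by (auto intro!: derivative_eq_intros)
    have "(f has_derivative (\<lambda>h. h \<bullet> D)) (at (u + (0::real) *\<^sub>R (v - u)))"
      using assms(2) by (simp add: gderiv_def)
    from has_derivative_compose[OF line this] show ?thesis
      unfolding \<phi>_def has_field_derivative_def
      by (rule has_derivative_eq_rhs) (simp add: fun_eq_iff inner_commute mult.commute)
  qed
  ultimately have "\<phi> 1 - \<phi> 0 \<ge> (D \<bullet> (v - u)) * (1 - 0)"
    by (intro convex_on_imp_above_tangent[where A=UNIV]) auto
  then show ?thesis by (simp add: \<phi>_def)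
qed

text \<open>Moving the multiplier along the residual \<open>A xs - b\<close> raises the Lagrangian
  by the squared norm of the residual, which maximality in the multiplier forbids unless it is
  zero.\<close>

lemma saddle_points_feasible:
  assumes "(xs, ls) \<in> saddle_points f A b"
  shows "A xs = b"
proof -
  have "lagrangian f A b xs (ls + (A xs - b)) \<le> lagrangian f A b xs ls"
    using assms by (auto simp: saddle_points_def)
  then have "(A xs - b) \<bullet> (A xs - b) \<le> 0"
    by (simp add: lagrangian_def inner_add_left)
  then have "(A xs - b) \<bullet> (A xs - b) = 0" using inner_ge_zero[of "A xs - b"] by linarith
  then show ?thesis by simp
qed

subsection \<open>Real analysis\<close>

lemma exp_rate_has_real_derivative:
  assumes "0 < t" "0 < \<delta>" "s < 1"
  shows "(exp_rate \<delta> s has_real_derivative exp_rate \<delta> s t * t powr (- s) / \<delta>) (at t)"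
proof -
  have "((\<lambda>t. 1 / (\<delta> * (1 - s)) * t powr (1 - s)) has_real_derivative t powr (- s) / \<delta>) (at t)"
    using assms by (auto intro!: derivative_eq_intros)
  from DERIV_fun_exp[OF this] show ?thesis
    by (simp add: exp_rate_def[abs_def])
qed

text \<open>The set where two continuous functions differ is open, and an open null set is
  empty.\<close>

lemma AE_continuous_eq_everywhere:
  fixes f g :: "real \<Rightarrow> 'a::real_normed_vector"
  assumes "open S" "continuous_on S f" "continuous_on S g"
    and ae: "AE t in lebesgue. t \<in> S \<longrightarrow> f t = g t" and "t \<in> S"
  shows "f t = g t"
proof (rule ccontr)
  assume neq: "f t \<noteq> g t"
  let ?U = "S \<inter> (\<lambda>t. f t - g t) -` (- {0})"
  have "open ?U"
    using assms by (intro continuous_open_preimage continuous_intros) auto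
  moreover have "negligible ?U"
  proof -
    obtain N where N: "N \<in> null_sets lebesgue" "{t. \<not> (t \<in> S \<longrightarrow> f t = g t)} \<subseteq> N"
      using ae unfolding eventually_ae_filter by auto
    have "?U \<subseteq> N" using N(2) by auto
    with N(1) show ?thesis using negligible_iff_null_sets negligible_subset by blast
  qed
  ultimately have "?U = {}" using open_not_negligible by blast
  then show False using neq \<open>t \<in> S\<close> by auto
qed

text \<open>A nonlinear Gronwall argument: \<open>sqrt (1 + E t) - H t / 2\<close> is nonincreasing.
  The 1 under the root keeps it differentiable where \<open>E\<close> vanishes.\<close>

lemma derivative_le_sqrt_imp_bounded:
  fixes E H :: "real \<Rightarrow> real"
  assumes E: "\<And>t. t > T \<Longrightarrow> (E has_real_derivative E' t) (at t)"
    and H: "\<And>t. t > T \<Longrightarrow> (H has_real_derivative H' t) (at t)"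
    and nonneg: "\<And>t. t > T \<Longrightarrow> 0 \<le> E t" "\<And>t. t > T \<Longrightarrow> 0 \<le> H' t"
    and le: "\<And>t. t > T \<Longrightarrow> E' t \<le> H' t * sqrt (E t)"
    and H_le: "\<And>t. t > T \<Longrightarrow> H t \<le> M"
  shows "\<exists>C. \<forall>t>T+1. E t \<le> C"
proof -
  \<comment> \<open>The comparison starts at \<open>T + 1\<close> because the hypotheses hold on an
    open half-line and say nothing at \<open>T\<close>.\<close>
  define C where "C = sqrt (1 + E (T + 1)) + (M - H (T + 1)) / 2"
  have "E t \<le> C\<^sup>2" if "t > T + 1" for t
  proof -
    let ?\<Phi> = "\<lambda>t. sqrt (1 + E t) - H t / 2"
    have "?\<Phi> t \<le> ?\<Phi> (T + 1)"
    proof (rule DERIV_nonpos_imp_nonincreasing[where f = ?\<Phi>])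
      fix x assume "T + 1 \<le> x" "x \<le> t"
      then have x: "x > T" by simp
      have pos: "1 + E x > 0" using nonneg(1)[OF x] by simp
      have "(?\<Phi> has_real_derivative E' x / (2 * sqrt (1 + E x)) - H' x / 2) (at x)"
        using pos by (auto intro!: derivative_eq_intros E[OF x] H[OF x] simp: field_simps)
      moreover have "E' x \<le> H' x * sqrt (1 + E x)"
      proof -
        have "H' x * sqrt (E x) \<le> H' x * sqrt (1 + E x)"
          using nonneg(2)[OF x] by (intro mult_left_mono) auto
        with le[OF x] show ?thesis by simp
      qed
      then have "E' x / (2 * sqrt (1 + E x)) - H' x / 2 \<le> 0"
        using pos by (simp add: field_simps)
      ultimately show "\<exists>y. (?\<Phi> has_real_derivative y) (at x) \<and> y \<le> 0" by blast
    qed (use that in simp)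
    then have "sqrt (1 + E t) \<le> C"
      using H_le[of t] that unfolding C_def by (simp add: field_simps)
    then have "(sqrt (1 + E t))\<^sup>2 \<le> C\<^sup>2"
      using nonneg(1)[of t] that by (intro power_mono) auto
    then show ?thesis using nonneg(1)[of t] that by simp
  qed
  then show ?thesis by blast
qed

text \<open>The exponent \<open>- 1 - q\<close> is integrable at infinity: the mean value inequality
  compares \<open>Z\<close> with the antiderivative \<open>?\<phi>\<close>, whose total increase
  from \<open>T + 1\<close> is finite.\<close>

lemma bounded_of_derivative_powr:
  fixes Z :: "real \<Rightarrow> 'a::real_normed_vector"
  assumes Z: "\<And>t. t > T \<Longrightarrow> (Z has_vector_derivative Z' t) (at t)"
    and le: "\<And>t. t > T \<Longrightarrow> norm (Z' t) \<le> C * t powr (- 1 - q)"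
    and "q > 0" "T > 0"
  shows "\<exists>B. \<forall>t>T+1. norm (Z t) \<le> B"
proof -
  let ?\<phi> = "\<lambda>t. - (C / q) * t powr (- q)"
  have \<phi>: "(?\<phi> has_vector_derivative C * t powr (- 1 - q)) (at t)" if "t > T" for t
    unfolding has_real_derivative_iff_has_vector_derivative[symmetric]
    using that assms(3,4)
    by (auto intro!: derivative_eq_intros simp: field_simps minus_diff_commute)
  have C: "0 \<le> C"
    using norm_ge_zero[of "Z' (T + 1)"] le[of "T + 1"] \<open>T > 0\<close>
    by (smt (verit) mult_less_0_iff powr_gt_zero)
  have "norm (Z t) \<le> norm (Z (T + 1)) + C / q * (T + 1) powr (- q)" if t: "t > T + 1" for t
  proof -
    have "norm (Z t - Z (T + 1)) \<le> ?\<phi> t - ?\<phi> (T + 1)"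
    proof (rule differentiable_bound_general[OF t])
      show "continuous_on {T + 1..t} Z" "continuous_on {T + 1..t} ?\<phi>"
        using Z \<phi> by (force intro!: continuous_at_imp_continuous_on has_vector_derivative_continuous)+
      fix x assume "T + 1 < x" "x < t"
      then have x: "x > T" by simp
      show "(Z has_vector_derivative Z' x) (at x)" by (rule Z[OF x])
      show "(?\<phi> has_vector_derivative C * x powr (- 1 - q)) (at x)" by (rule \<phi>[OF x])
      show "norm (Z' x) \<le> C * x powr (- 1 - q)" by (rule le[OF x])
    qed
    moreover have "0 \<le> C / q * t powr (- q)" using C \<open>q > 0\<close> by simp
    ultimately show ?thesis using norm_triangle_sub[of "Z t" "Z (T + 1)"] by simp
  qed
  then show ?thesis by blast
qed

lemma exp_rate_pos [simp]: "0 < exp_rate \<delta> s t"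
  by (simp add: exp_rate_def)

subsection \<open>Energy estimates\<close>

lemma powr_square: "(t powr a)\<^sup>2 = t powr (2 * a)" for t a :: real
  by (simp add: power2_eq_square flip: powr_add)

text \<open>The algebra of the energy derivative at a frozen time: \<open>x1\<close>,
  \<open>x2\<close>, \<open>l1\<close>, \<open>l2\<close> stand for time derivatives,
  \<open>y\<close> and \<open>z\<close> for the displacements from the saddle point,
  \<open>B\<close> for the scaling, \<open>p\<close> for the energy weight. Here \<open>q\<close> is
  the friction coefficient, not the exponent defined later.\<close>

lemma energy_derivative_identity:
  fixes y x1 x2 G At_w e :: "'a::real_inner" and z l1 l2 Av :: "'b::real_inner"
  assumes v: "v = y + \<gamma> *\<^sub>R x1" and w: "w = z + \<gamma> *\<^sub>R l1"
    and x2: "x2 = - (q *\<^sub>R x1) - B *\<^sub>R (G + At_w) + e" and l2: "l2 = - (q *\<^sub>R l1) + B *\<^sub>R Av"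
    and adj: "Av \<bullet> w = v \<bullet> At_w"
    and P: "P = p * (\<gamma> * q - 1 - \<gamma>')"
  shows "p * (v \<bullet> (x1 + \<gamma>' *\<^sub>R x1 + \<gamma> *\<^sub>R x2) + w \<bullet> (l1 + \<gamma>' *\<^sub>R l1 + \<gamma> *\<^sub>R l2))
      + P * (y \<bullet> x1 + z \<bullet> l1) + (p * \<gamma> * B * F + p * \<gamma>\<^sup>2 * B * (G \<bullet> x1))
    = - P * \<gamma> * (x1 \<bullet> x1 + l1 \<bullet> l1) + p * \<gamma> * (e \<bullet> v) - p * \<gamma> * B * (G \<bullet> y - F)"
proof -
  \<comment> \<open>The term \<open>B * (v \<bullet> At_w)\<close> occurs in \<open>vx\<close> and
    \<open>wl\<close> with opposite signs, so the coupling drops out of the sum.\<close>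
  have vx: "v \<bullet> x2 = - q * (v \<bullet> x1) - B * (G \<bullet> v) - B * (v \<bullet> At_w) + e \<bullet> v"
    by (simp add: x2 inner_simps inner_commute algebra_simps)
  have wl: "w \<bullet> l2 = - q * (w \<bullet> l1) + B * (v \<bullet> At_w)"
    by (simp add: l2 inner_simps inner_commute[of w Av] adj algebra_simps)
  \<comment> \<open>The velocity terms collect the coefficient
    \<open>p * (1 + \<gamma>' - \<gamma> * q)\<close>, which is \<open>- P\<close>; expanding
    \<open>v\<close> and \<open>w\<close> then cancels the mixed products with \<open>y\<close> and
    \<open>z\<close>.\<close>
  have "p * (v \<bullet> (x1 + \<gamma>' *\<^sub>R x1 + \<gamma> *\<^sub>R x2) + w \<bullet> (l1 + \<gamma>' *\<^sub>R l1 + \<gamma> *\<^sub>R l2))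
     = - P * (v \<bullet> x1 + w \<bullet> l1) - p * \<gamma> * B * (G \<bullet> v) + p * \<gamma> * (e \<bullet> v)"
    by (simp add: inner_add_right vx wl P algebra_simps)
  moreover have "v \<bullet> x1 = y \<bullet> x1 + \<gamma> * (x1 \<bullet> x1)" "w \<bullet> l1 = z \<bullet> l1 + \<gamma> * (l1 \<bullet> l1)"
    "G \<bullet> v = G \<bullet> y + \<gamma> * (G \<bullet> x1)"
    by (simp_all add: v w inner_simps)
  ultimately show ?thesis
    by (simp add: algebra_simps power2_eq_square)
qed

text \<open>The problem reduced to what the energy estimates use: a nonnegative gap \<open>F\<close>
  with gradient \<open>G\<close>, into which the multiplier \<open>ls\<close> and the \<sigma>-term
  are absorbed, and equations that hold at every \<open>t > T\<close> instead of almost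
  everywhere.\<close>

locale primal_dual_trajectory =
  fixes A :: "'a::real_inner \<Rightarrow> 'b::real_inner" and At :: "'b \<Rightarrow> 'a"
    and F :: "'a \<Rightarrow> real" and G :: "'a \<Rightarrow> 'a" and xs :: 'a and ls :: 'b
    and \<alpha> \<delta> \<mu> r s \<tau> T :: real
    and e x x1 x2 :: "real \<Rightarrow> 'a" and l l1 l2 :: "real \<Rightarrow> 'b"
  assumes linear: "bounded_linear A"
    and adjoint: "A u \<bullet> w = u \<bullet> At w"
    and F_nonneg: "0 \<le> F u"
    and F_gderiv: "GDERIV F u :> G u"
    and F_le: "F u \<le> G u \<bullet> (u - xs)"
    and T_pos: "0 < T" and \<alpha>_pos: "0 < \<alpha>" and \<delta>_pos: "0 < \<delta>" and \<mu>_pos: "0 < \<mu>"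
    and r_less: "r < 1" and r_le: "r \<le> s" and s_less: "s < 1"
    and \<tau>_less: "\<tau> < r + s"
    and damping: "s = r \<Longrightarrow> 1 < \<alpha> * \<delta>"
    and x_deriv: "t > T \<Longrightarrow> (x has_vector_derivative x1 t) (at t)"
    and x1_deriv: "t > T \<Longrightarrow> (x1 has_vector_derivative x2 t) (at t)"
    and l_deriv: "t > T \<Longrightarrow> (l has_vector_derivative l1 t) (at t)"
    and l1_deriv: "t > T \<Longrightarrow> (l1 has_vector_derivative l2 t) (at t)"
    and primal: "t > T \<Longrightarrow> x2 t + (\<alpha> / t powr r) *\<^sub>R x1 t =
      - (scaling \<mu> \<delta> s \<tau> t *\<^sub>R (G (x t) + At (l t - ls + (\<delta> * t powr s) *\<^sub>R l1 t))) + e t"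
    and dual: "t > T \<Longrightarrow> l2 t + (\<alpha> / t powr r) *\<^sub>R l1 t =
      scaling \<mu> \<delta> s \<tau> t *\<^sub>R A (x t - xs + (\<delta> * t powr s) *\<^sub>R x1 t)"
begin

section \<open>The energy and its formal derivative\<close>

definition v where "v t = x t - xs + (\<delta> * t powr s) *\<^sub>R x1 t"

definition w where "w t = l t - ls + (\<delta> * t powr s) *\<^sub>R l1 t"

text \<open>\<open>t powr (- 2 * q)\<close> is the order of the friction term of \<open>P\<close>; a
  bounded energy lets \<open>l - ls\<close> grow at most like \<open>t powr q\<close>.\<close>

definition q where "q = (s + r - \<tau>) / 2"

text \<open>
  \<open>P\<close> is \<open>t powr (\<tau> - 2 s) (\<gamma> \<alpha> / t\<^sup>r - 1 - \<gamma>')\<close>, the weight for which the mixed terms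
  \<open>(x - x\<^sup>*) \<bullet> x'\<close> and \<open>(\<lambda> - \<lambda>\<^sup>*) \<bullet> \<lambda>'\<close> in the derivative of the energy cancel.
\<close>

definition P where
  "P t = \<alpha> * \<delta> * t powr (- 2 * q) - t powr (\<tau> - 2 * s) - \<delta> * s * t powr (\<tau> - s - 1)"

definition P' where
  "P' t = \<alpha> * \<delta> * (- 2 * q) * t powr (- 2 * q - 1) - (\<tau> - 2 * s) * t powr (\<tau> - 2 * s - 1)
     - \<delta> * s * (\<tau> - s - 1) * t powr (\<tau> - s - 2)"

definition energy where
  "energy t = t powr (\<tau> - 2 * s) / 2 * (v t \<bullet> v t + w t \<bullet> w t)
     + P t / 2 * ((x t - xs) \<bullet> (x t - xs) + (l t - ls) \<bullet> (l t - ls))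
     + \<delta>\<^sup>2 * \<mu> * exp_rate \<delta> s t * F (x t)"

text \<open>The energy derivative after all cancellations. Once \<open>0 \<le> P t\<close> and
  \<open>P' t \<le> 0\<close>, every summand except the one with \<open>e t\<close> is
  nonpositive.\<close>

definition energy' where
  "energy' t = (\<tau> - 2 * s) * t powr (\<tau> - 2 * s - 1) / 2 * (v t \<bullet> v t + w t \<bullet> w t)
     + P' t / 2 * ((x t - xs) \<bullet> (x t - xs) + (l t - ls) \<bullet> (l t - ls))
     - P t * (\<delta> * t powr s) * (x1 t \<bullet> x1 t + l1 t \<bullet> l1 t)
     + t powr (\<tau> - 2 * s) * (\<delta> * t powr s) * (e t \<bullet> v t)
     - \<delta> * \<mu> * exp_rate \<delta> s t * t powr (- s) * (G (x t) \<bullet> (x t - xs) - F (x t))"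

section \<open>Signs of the exponents and asymptotics of the weight \<open>P\<close>\<close>

lemma q_pos: "0 < q" and two_s: "\<tau> < 2 * s"
  using \<tau>_less r_le by (auto simp: q_def)

lemma two_q: "- 2 * q = \<tau> - s - r"
  by (simp add: q_def field_simps)

lemma P_has_derivative: "t > T \<Longrightarrow> (P has_real_derivative P' t) (at t)"
  unfolding P_def[abs_def] P'_def using T_pos
  by (auto intro!: derivative_eq_intros simp: algebra_simps)

text \<open>After division by \<open>t powr (- 2 * q)\<close> and
  \<open>t powr (- 2 * q - 1)\<close>, \<open>P\<close> and \<open>P'\<close> converge to
  \<open>\<alpha> * \<delta> - k\<close> and to \<open>- 2 * q\<close> times this positive
  number.\<close>

lemma P_eventually: "\<exists>c>0. \<forall>\<^sub>F t in at_top. c * t powr (- 2 * q) \<le> P t \<and> P' t \<le> 0"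
proof -
  \<comment> \<open>\<open>k\<close> is the limit of \<open>t powr (r - s)\<close>. It is nonzero
    exactly when \<open>s = r\<close>, and there the damping condition makes
    \<open>\<alpha> * \<delta>\<close> exceed it.\<close>
  define k :: real where "k = (if s = r then 1 else 0)"
  have k: "k < \<alpha> * \<delta>" using damping \<alpha>_pos \<delta>_pos by (auto simp: k_def)
  have lim_k: "((\<lambda>t. t powr (r - s)) \<longlongrightarrow> k) at_top"
  proof (cases "s = r")
    case True
    then have "\<forall>\<^sub>F t in at_top. t powr (r - s) = k"
      by (intro eventually_mono[OF eventually_gt_at_top[of 0]]) (simp add: k_def)
    then show ?thesis by (rule tendsto_eventually)
  next
    case False
    with r_le show ?thesis by (auto simp: k_def intro!: tendsto_neg_powr filterlim_ident)
  qed
  have lim_0: "((\<lambda>t. t powr (r - 1)) \<longlongrightarrow> 0) at_top"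
    using r_less by (intro tendsto_neg_powr filterlim_ident) simp
  define c where "c = (\<alpha> * \<delta> - k) / 2"
  have "((\<lambda>t. \<alpha> * \<delta> - t powr (r - s) - \<delta> * s * t powr (r - 1)) \<longlongrightarrow> \<alpha> * \<delta> - k - \<delta> * s * 0) at_top"
    by (intro tendsto_intros lim_k lim_0)
  then have "\<forall>\<^sub>F t in at_top. c < \<alpha> * \<delta> - t powr (r - s) - \<delta> * s * t powr (r - 1)"
    by (rule order_tendstoD(1)) (use k in \<open>simp add: c_def field_simps\<close>)
  moreover have "((\<lambda>t. \<alpha> * \<delta> * (- 2 * q) - (\<tau> - 2 * s) * t powr (r - s)
      - \<delta> * s * (\<tau> - s - 1) * t powr (r - 1)) \<longlongrightarrow>
      \<alpha> * \<delta> * (- 2 * q) - (\<tau> - 2 * s) * k - \<delta> * s * (\<tau> - s - 1) * 0) at_top"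
    by (intro tendsto_intros lim_k lim_0)
  then have "\<forall>\<^sub>F t in at_top. \<alpha> * \<delta> * (- 2 * q) - (\<tau> - 2 * s) * t powr (r - s)
      - \<delta> * s * (\<tau> - s - 1) * t powr (r - 1) < 0"
  proof (rule order_tendstoD(2))
    \<comment> \<open>If \<open>s = r\<close> the two exponents coincide; otherwise \<open>k\<close>
      is zero.\<close>
    have "(\<tau> - 2 * s) * k = - 2 * q * k" by (simp add: k_def q_def)
    then have "\<alpha> * \<delta> * (- 2 * q) - (\<tau> - 2 * s) * k = - 2 * q * (\<alpha> * \<delta> - k)"
      by (simp add: algebra_simps)
    moreover have "0 < q * (\<alpha> * \<delta> - k)" using q_pos k by simp
    ultimately show "\<alpha> * \<delta> * (- 2 * q) - (\<tau> - 2 * s) * k - \<delta> * s * (\<tau> - s - 1) * 0 < 0" by simp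
  qed
  ultimately have "\<forall>\<^sub>F t in at_top. c * t powr (- 2 * q) \<le> P t \<and> P' t \<le> 0"
    using eventually_gt_at_top[of 0]
  proof eventually_elim
    case (elim t)
    have "t powr (- 2 * q) * (\<alpha> * \<delta> - t powr (r - s) - \<delta> * s * t powr (r - 1)) = P t"
    proof -
      have a: "t powr (\<tau> - 2 * s) = t powr (- 2 * q) * t powr (r - s)"
        "t powr (\<tau> - s - 1) = t powr (- 2 * q) * t powr (r - 1)"
        unfolding two_q by (simp_all add: algebra_simps flip: powr_add)
      show ?thesis unfolding P_def a by (simp add: algebra_simps)
    qed
    moreover have "t powr (- 2 * q - 1) * (\<alpha> * \<delta> * (- 2 * q) - (\<tau> - 2 * s) * t powr (r - s)
      - \<delta> * s * (\<tau> - s - 1) * t powr (r - 1)) = P' t"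
    proof -
      have a: "t powr (\<tau> - 2 * s - 1) = t powr (- 2 * q - 1) * t powr (r - s)"
        "t powr (\<tau> - s - 2) = t powr (- 2 * q - 1) * t powr (r - 1)"
        unfolding two_q by (simp_all add: algebra_simps flip: powr_add)
      show ?thesis unfolding P'_def a by (simp add: algebra_simps)
    qed
    moreover have "t powr (- 2 * q) * c \<le>
        t powr (- 2 * q) * (\<alpha> * \<delta> - t powr (r - s) - \<delta> * s * t powr (r - 1))"
      using elim by (intro mult_left_mono) auto
    ultimately show ?case using elim
      by (metis less_imp_le mult.commute mult_nonneg_nonpos powr_ge_zero)
  qed
  moreover have "c > 0" using k by (simp add: c_def)
  ultimately show ?thesis by blast
qed

text \<open>Termwise differentiation gives \<open>?D\<close>; the pointwise identity, with the
  system solved for \<open>x2\<close> and \<open>l2\<close>, simplifies it to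
  \<open>energy'\<close>.\<close>

lemma energy_has_derivative:
  assumes t: "t > T"
  shows "(energy has_real_derivative energy' t) (at t)"
proof -
  have t0: "t > 0" using t T_pos by simp
  let ?\<gamma> = "\<delta> * t powr s" and ?\<gamma>' = "\<delta> * (s * t powr (s - 1))" and ?p = "t powr (\<tau> - 2 * s)"
  let ?B = "scaling \<mu> \<delta> s \<tau> t" and ?g = "exp_rate \<delta> s t"
  have \<gamma>: "((\<lambda>t. \<delta> * t powr s) has_real_derivative ?\<gamma>') (at t)"
    using t0 by (auto intro!: derivative_eq_intros)
  have v': "(v has_vector_derivative x1 t + ?\<gamma>' *\<^sub>R x1 t + ?\<gamma> *\<^sub>R x2 t) (at t)"
    unfolding v_def[abs_def]
    by (rule derivative_eq_intros \<gamma>[unfolded has_real_derivative_iff_has_vector_derivative]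
        x_deriv[OF t] x1_deriv[OF t] \<gamma> refl)+ (simp add: algebra_simps)
  have w': "(w has_vector_derivative l1 t + ?\<gamma>' *\<^sub>R l1 t + ?\<gamma> *\<^sub>R l2 t) (at t)"
    unfolding w_def[abs_def]
    by (rule derivative_eq_intros \<gamma>[unfolded has_real_derivative_iff_has_vector_derivative]
        l_deriv[OF t] l1_deriv[OF t] \<gamma> refl)+ (simp add: algebra_simps)
  have x': "((\<lambda>t. x t - xs) has_vector_derivative x1 t) (at t)"
    by (rule derivative_eq_intros x_deriv[OF t] refl)+ simp
  have l': "((\<lambda>t. l t - ls) has_vector_derivative l1 t) (at t)"
    by (rule derivative_eq_intros l_deriv[OF t] refl)+ simp
  have sq: "((\<lambda>t. u t \<bullet> u t) has_real_derivative 2 * (u t \<bullet> u')) (at t)"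
    if "(u has_vector_derivative u') (at t)" for u :: "real \<Rightarrow> 'c::real_inner" and u'
  proof -
    note d = that[unfolded has_vector_derivative_def]
    show ?thesis unfolding has_field_derivative_def
      by (rule has_derivative_eq_rhs[OF has_derivative_inner[OF d d]])
        (simp add: fun_eq_iff inner_commute)
  qed
  have F': "((\<lambda>t. F (x t)) has_real_derivative G (x t) \<bullet> x1 t) (at t)"
    using has_derivative_compose[OF x_deriv[OF t, unfolded has_vector_derivative_def]
        F_gderiv[of "x t", unfolded gderiv_def]]
    unfolding has_field_derivative_def
    by (rule has_derivative_eq_rhs) (simp add: fun_eq_iff inner_commute)
  have g': "(exp_rate \<delta> s has_real_derivative ?g * t powr (- s) / \<delta>) (at t)"
    by (rule exp_rate_has_real_derivative[OF t0 \<delta>_pos s_less])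
  have p': "((\<lambda>t. t powr (\<tau> - 2 * s)) has_real_derivative (\<tau> - 2 * s) * t powr (\<tau> - 2 * s - 1)) (at t)"
    using t0 by (auto intro!: derivative_eq_intros)
  \<comment> \<open>The weight \<open>?p\<close> is chosen so that
    \<open>?p * ?\<gamma>\<^sup>2 * ?B\<close> is a constant multiple of \<open>?g\<close>; since
    \<open>?g\<close> has derivative \<open>?g / ?\<gamma>\<close>, the derivative of the
    \<open>F\<close>-term then has exactly the coefficients of the identity.\<close>
  have pB1: "\<delta>\<^sup>2 * \<mu> * (?g * t powr (- s) / \<delta>) = ?p * ?\<gamma> * ?B"
  proof -
    have "?p * t powr s / t powr \<tau> = t powr (- s)"
      using t0 by (simp flip: powr_add powr_diff)
    then have "\<delta> * \<mu> * ?g * (?p * t powr s / t powr \<tau>) = \<delta> * \<mu> * ?g * t powr (- s)" by simp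
    then show ?thesis using \<delta>_pos by (simp add: scaling_def power2_eq_square mult_ac)
  qed
  have pB2: "\<delta>\<^sup>2 * \<mu> * ?g = ?p * ?\<gamma>\<^sup>2 * ?B"
  proof -
    have "?p * (t powr s)\<^sup>2 / t powr \<tau> = 1"
      using t0 by (simp add: power2_eq_square flip: powr_add powr_diff)
    then have "\<delta>\<^sup>2 * \<mu> * ?g * (?p * (t powr s)\<^sup>2 / t powr \<tau>) = \<delta>\<^sup>2 * \<mu> * ?g" by simp
    then show ?thesis by (simp add: scaling_def power_mult_distrib mult_ac)
  qed
  have P_eq: "P t = ?p * (?\<gamma> * (\<alpha> / t powr r) - 1 - ?\<gamma>')"
  proof -
    have a: "t powr (- 2 * q) = ?p * t powr s / t powr r"
      unfolding two_q using t0 by (simp add: algebra_simps flip: powr_add powr_diff)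
    have b: "t powr (\<tau> - s - 1) = ?p * t powr (s - 1)"
      by (simp add: algebra_simps flip: powr_add)
    show ?thesis unfolding P_def a b by (simp add: algebra_simps)
  qed
  have "(energy has_real_derivative
     (\<tau> - 2 * s) * t powr (\<tau> - 2 * s - 1) / 2 * (v t \<bullet> v t + w t \<bullet> w t)
     + (2 * (v t \<bullet> (x1 t + ?\<gamma>' *\<^sub>R x1 t + ?\<gamma> *\<^sub>R x2 t))
          + 2 * (w t \<bullet> (l1 t + ?\<gamma>' *\<^sub>R l1 t + ?\<gamma> *\<^sub>R l2 t))) * (?p / 2)
     + (P' t / 2 * ((x t - xs) \<bullet> (x t - xs) + (l t - ls) \<bullet> (l t - ls))
     + (2 * ((x t - xs) \<bullet> x1 t) + 2 * ((l t - ls) \<bullet> l1 t)) * (P t / 2))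
     + (\<delta>\<^sup>2 * \<mu> * (?g * t powr (- s) / \<delta>) * F (x t) + G (x t) \<bullet> x1 t * (\<delta>\<^sup>2 * \<mu> * ?g))) (at t)"
    (is "(_ has_real_derivative ?D) _")
    unfolding energy_def[abs_def]
    by (intro DERIV_add DERIV_mult DERIV_cmult DERIV_cdivide p' P_has_derivative[OF t]
        sq[OF v'] sq[OF w'] sq[OF x'] sq[OF l'] g' F')
  moreover have "?D = energy' t"
  proof -
    have diff: "u = - c + d" if "u + c = d" for u c d :: "'c::real_vector"
      using that by (auto simp: algebra_simps)
    have "x2 t = - ((\<alpha> / t powr r) *\<^sub>R x1 t) - ?B *\<^sub>R (G (x t) + At (w t)) + e t"
      using diff[OF primal[OF t]] by (simp add: w_def)
    moreover have "l2 t = - ((\<alpha> / t powr r) *\<^sub>R l1 t) + ?B *\<^sub>R A (v t)"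
      using diff[OF dual[OF t]] by (simp add: v_def)
    ultimately have "?p * (v t \<bullet> (x1 t + ?\<gamma>' *\<^sub>R x1 t + ?\<gamma> *\<^sub>R x2 t) + w t \<bullet> (l1 t + ?\<gamma>' *\<^sub>R l1 t + ?\<gamma> *\<^sub>R l2 t))
      + P t * ((x t - xs) \<bullet> x1 t + (l t - ls) \<bullet> l1 t)
      + (?p * ?\<gamma> * ?B * F (x t) + ?p * ?\<gamma>\<^sup>2 * ?B * (G (x t) \<bullet> x1 t))
    = - P t * ?\<gamma> * (x1 t \<bullet> x1 t + l1 t \<bullet> l1 t) + ?p * ?\<gamma> * (e t \<bullet> v t)
      - ?p * ?\<gamma> * ?B * (G (x t) \<bullet> (x t - xs) - F (x t))"
      by (intro energy_derivative_identity[OF v_def w_def _ _ adjoint P_eq])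
    moreover have pB3: "\<delta> * \<mu> * ?g * t powr (- s) = ?p * ?\<gamma> * ?B"
      using pB1 \<delta>_pos by (simp add: power2_eq_square)
    ultimately show ?thesis unfolding energy'_def pB1 pB2 pB3 by (simp add: field_simps)
  qed
  ultimately show ?thesis by simp
qed

text \<open>Only the perturbation term can be positive. Cauchy-Schwarz bounds it by
  \<open>norm (e t) * norm (v t)\<close>, and the energy controls the weighted norm of
  \<open>v t\<close>.\<close>

lemma energy'_le:
  assumes t: "t > T" and P: "0 \<le> P t" "P' t \<le> 0"
  shows "energy' t \<le> sqrt 2 * \<delta> * (t powr (\<tau> / 2) * norm (e t)) * sqrt (energy t)"
proof -
  have t0: "t > 0" using t T_pos by simp
  have "energy' t \<le> t powr (\<tau> - 2 * s) * (\<delta> * t powr s) * (e t \<bullet> v t)"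
  proof -
    have "(\<tau> - 2 * s) * t powr (\<tau> - 2 * s - 1) / 2 * (v t \<bullet> v t + w t \<bullet> w t) \<le> 0"
      using two_s by (intro mult_nonpos_nonneg divide_nonpos_pos) auto
    moreover have "P' t / 2 * ((x t - xs) \<bullet> (x t - xs) + (l t - ls) \<bullet> (l t - ls)) \<le> 0"
      using P by (intro mult_nonpos_nonneg) auto
    moreover have "0 \<le> P t * (\<delta> * t powr s) * (x1 t \<bullet> x1 t + l1 t \<bullet> l1 t)"
      using P \<delta>_pos by (intro mult_nonneg_nonneg) auto
    moreover have "0 \<le> \<delta> * \<mu> * exp_rate \<delta> s t * t powr (- s) * (G (x t) \<bullet> (x t - xs) - F (x t))"
      using \<delta>_pos \<mu>_pos F_le[of "x t"] by (intro mult_nonneg_nonneg) (auto simp: less_imp_le)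
    ultimately show ?thesis unfolding energy'_def by linarith
  qed
  also have "\<dots> \<le> t powr (\<tau> - 2 * s) * (\<delta> * t powr s) * (norm (e t) * norm (v t))"
    using \<delta>_pos by (intro mult_left_mono norm_cauchy_schwarz) auto
  \<comment> \<open>The total power \<tau> - s is split so that \<open>e\<close> receives the weight
    of the integrability hypothesis and \<open>v\<close> the square root of its weight in the
    energy.\<close>
  also have "\<dots> = \<delta> * (t powr (\<tau> / 2) * norm (e t)) * (t powr (\<tau> / 2 - s) * norm (v t))"
  proof -
    have "t powr (\<tau> - 2 * s) * t powr s = t powr (\<tau> / 2) * t powr (\<tau> / 2 - s)"
      by (simp flip: powr_add)
    then have "\<delta> * norm (e t) * norm (v t) * (t powr (\<tau> - 2 * s) * t powr s)
      = \<delta> * norm (e t) * norm (v t) * (t powr (\<tau> / 2) * t powr (\<tau> / 2 - s))" by simp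
    then show ?thesis by (simp only: mult_ac)
  qed
  also have "\<dots> \<le> \<delta> * (t powr (\<tau> / 2) * norm (e t)) * sqrt (2 * energy t)"
  proof (intro mult_left_mono real_le_rsqrt)
    have "(t powr (\<tau> / 2 - s) * norm (v t))\<^sup>2 = t powr (\<tau> - 2 * s) * (v t \<bullet> v t)"
      by (simp add: power_mult_distrib power2_norm_eq_inner powr_square right_diff_distrib)
    also have "\<dots> \<le> 2 * energy t"
    proof -
      have "0 \<le> P t / 2 * ((x t - xs) \<bullet> (x t - xs) + (l t - ls) \<bullet> (l t - ls))"
        using P by (intro mult_nonneg_nonneg) auto
      moreover have "0 \<le> \<delta>\<^sup>2 * \<mu> * exp_rate \<delta> s t * F (x t)"
        using \<mu>_pos F_nonneg by (intro mult_nonneg_nonneg) (auto simp: less_imp_le)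
      moreover have "0 \<le> t powr (\<tau> - 2 * s) / 2 * (w t \<bullet> w t)" by simp
      ultimately show ?thesis unfolding energy_def by (simp add: distrib_left)
    qed
    finally show "(t powr (\<tau> / 2 - s) * norm (v t))\<^sup>2 \<le> 2 * energy t" .
  qed (use \<delta>_pos in auto)
  finally show ?thesis by (simp add: real_sqrt_mult mult_ac)
qed

text \<open>\<open>H\<close> is a bounded primitive of the weighted perturbation, so the
  differential inequality for the energy falls under the Gronwall argument. The lower bound on
  \<open>P\<close> is returned as well, to extract a bound on \<open>l\<close> from the
  energy.\<close>

lemma energy_bounded:
  assumes H: "\<And>t. t > T \<Longrightarrow> (H has_real_derivative t powr (\<tau> / 2) * norm (e t)) (at t)"
    and H_le: "\<And>t. t > T \<Longrightarrow> H t \<le> M"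
  shows "\<exists>C c. 0 < c \<and> (\<forall>\<^sub>F t in at_top. c * t powr (- 2 * q) \<le> P t \<and> energy t \<le> C)"
proof -
  obtain c where "c > 0" and c: "\<forall>\<^sub>F t in at_top. c * t powr (- 2 * q) \<le> P t \<and> P' t \<le> 0"
    using P_eventually by blast
  then obtain T1 where T1: "\<And>t. t \<ge> T1 \<Longrightarrow> c * t powr (- 2 * q) \<le> P t \<and> P' t \<le> 0"
    unfolding eventually_at_top_linorder by blast
  define S where "S = max T T1"
  have *: "0 \<le> P t" "P' t \<le> 0" "t > T" if "t > S" for t
  proof -
    have "0 \<le> c * t powr (- 2 * q)" using \<open>c > 0\<close> by simp
    with T1[of t] that show "0 \<le> P t" "P' t \<le> 0" "t > T" by (auto simp: S_def)
  qed
  have "\<exists>C. \<forall>t>S+1. energy t \<le> C"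
  proof (rule derivative_le_sqrt_imp_bounded)
    fix t assume t: "t > S"
    show "(energy has_real_derivative energy' t) (at t)"
      using energy_has_derivative * t by blast
    show "((\<lambda>t. sqrt 2 * \<delta> * H t) has_real_derivative sqrt 2 * \<delta> * (t powr (\<tau> / 2) * norm (e t))) (at t)"
      by (intro DERIV_cmult H *(3) t)
    show "0 \<le> sqrt 2 * \<delta> * (t powr (\<tau> / 2) * norm (e t))" using \<delta>_pos by simp
    show "energy' t \<le> sqrt 2 * \<delta> * (t powr (\<tau> / 2) * norm (e t)) * sqrt (energy t)"
      using energy'_le * t by blast
    show "sqrt 2 * \<delta> * H t \<le> sqrt 2 * \<delta> * M"
      using H_le *(3)[OF t] \<delta>_pos by (intro mult_left_mono) auto
    show "0 \<le> energy t"
      using * t \<mu>_pos F_nonneg unfolding energy_def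
      by (intro add_nonneg_nonneg mult_nonneg_nonneg) (auto simp: less_imp_le)
  qed
  then obtain C where "\<And>t. t > S + 1 \<Longrightarrow> energy t \<le> C" by blast
  then have "\<forall>\<^sub>F t in at_top. energy t \<le> C"
    by (rule eventually_mono[OF eventually_gt_at_top])
  with c have "\<forall>\<^sub>F t in at_top. c * t powr (- 2 * q) \<le> P t \<and> energy t \<le> C"
    by eventually_elim simp
  with \<open>c > 0\<close> show ?thesis by blast
qed

text \<open>
  By the dual equation the derivative of \<open>g A (x - x\<^sup>*)\<close> is a multiple of
  \<open>t powr (\<tau> - s) (\<lambda>'' + \<alpha> / t\<^sup>r \<lambda>')\<close>; \<open>Z\<close> subtracts the boundary terms of the integration by parts.
\<close>

definition Z where
  "Z t = exp_rate \<delta> s t *\<^sub>R A (x t - xs)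
     - (1 / (\<delta> * \<mu>)) *\<^sub>R (t powr (\<tau> - s) *\<^sub>R l1 t + (\<alpha> * t powr (- 2 * q)) *\<^sub>R (l t - ls))"

text \<open>What remains of the derivative of \<open>Z\<close> once \<open>x1\<close> and
  \<open>l2\<close> are gone: only the derivatives of the power weights.\<close>

definition Z' where
  "Z' t = - (1 / (\<delta> * \<mu>)) *\<^sub>R (((\<tau> - s) * t powr (\<tau> - s - 1)) *\<^sub>R l1 t
     + (\<alpha> * (- 2 * q) * t powr (- 2 * q - 1)) *\<^sub>R (l t - ls))"

text \<open>The derivative of \<open>g A (x - xs)\<close> is \<open>g / \<gamma>\<close> times
  \<open>A (x - xs + \<gamma> x1)\<close>. The dual equation turns this into exactly the
  \<open>l2\<close> and \<open>l1\<close> terms that differentiating the correction produces with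
  the opposite sign.\<close>

lemma Z_has_derivative:
  assumes t: "t > T"
  shows "(Z has_vector_derivative Z' t) (at t)"
proof -
  have t0: "t > 0" using t T_pos by simp
  let ?g = "exp_rate \<delta> s t"
  interpret A: bounded_linear A by (rule linear)
  have x': "((\<lambda>t. A (x t - xs)) has_vector_derivative A (x1 t)) (at t)"
    by (rule A.has_vector_derivative) (auto intro!: derivative_eq_intros x_deriv[OF t])
  have g': "(exp_rate \<delta> s has_real_derivative ?g * t powr (- s) / \<delta>) (at t)"
    by (rule exp_rate_has_real_derivative[OF t0 \<delta>_pos s_less])
  have p': "((\<lambda>t. t powr a) has_real_derivative a * t powr (a - 1)) (at t)" for a
    using t0 by (auto intro!: derivative_eq_intros)
  have p'': "((\<lambda>t. \<alpha> * t powr a) has_real_derivative \<alpha> * (a * t powr (a - 1))) (at t)" for a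
    by (intro DERIV_cmult p')
  have l': "((\<lambda>t. l t - ls) has_vector_derivative l1 t) (at t)"
    by (rule derivative_eq_intros l_deriv[OF t] refl)+ simp
  have "(Z has_vector_derivative
     (?g *\<^sub>R A (x1 t) + (?g * t powr (- s) / \<delta>) *\<^sub>R A (x t - xs))
     - (1 / (\<delta> * \<mu>)) *\<^sub>R ((t powr (\<tau> - s) *\<^sub>R l2 t + ((\<tau> - s) * t powr (\<tau> - s - 1)) *\<^sub>R l1 t)
        + ((\<alpha> * t powr (- 2 * q)) *\<^sub>R l1 t
        + (\<alpha> * (- 2 * q * t powr (- 2 * q - 1))) *\<^sub>R (l t - ls)))) (at t)"
    unfolding Z_def[abs_def]
    by (intro has_vector_derivative_diff has_vector_derivative_add has_vector_derivative_scaleR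
        bounded_linear.has_vector_derivative[OF bounded_linear_scaleR_right] x' g' p' p'' l' l1_deriv[OF t])
  moreover have "?g *\<^sub>R A (x1 t) + (?g * t powr (- s) / \<delta>) *\<^sub>R A (x t - xs)
    = (1 / (\<delta> * \<mu>)) *\<^sub>R (t powr (\<tau> - s) *\<^sub>R l2 t + (\<alpha> * t powr (- 2 * q)) *\<^sub>R l1 t)"
  proof -
    have "(1 / (\<delta> * \<mu>)) *\<^sub>R (t powr (\<tau> - s) *\<^sub>R l2 t + (\<alpha> * t powr (- 2 * q)) *\<^sub>R l1 t)
      = (t powr (\<tau> - s) / (\<delta> * \<mu>)) *\<^sub>R (l2 t + (\<alpha> / t powr r) *\<^sub>R l1 t)"
    proof -
      have a: "t powr (- 2 * q) = t powr (\<tau> - s) / t powr r"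
        unfolding two_q using t0 by (simp add: algebra_simps flip: powr_diff)
      show ?thesis unfolding a by (simp add: scaleR_add_right mult.commute)
    qed
    also have "\<dots> = (t powr (\<tau> - s) / (\<delta> * \<mu>) * scaling \<mu> \<delta> s \<tau> t) *\<^sub>R A (x t - xs + (\<delta> * t powr s) *\<^sub>R x1 t)"
      by (simp add: dual[OF t])
    also have "t powr (\<tau> - s) / (\<delta> * \<mu>) * scaling \<mu> \<delta> s \<tau> t = ?g * t powr (- s) / \<delta>"
    proof -
      have "t powr (\<tau> - s) = t powr (- s) * t powr \<tau>" by (simp flip: powr_add)
      then show ?thesis using \<delta>_pos \<mu>_pos t0 by (simp add: scaling_def field_simps)
    qed
    also have "(?g * t powr (- s) / \<delta>) *\<^sub>R A (x t - xs + (\<delta> * t powr s) *\<^sub>R x1 t)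
      = ?g *\<^sub>R A (x1 t) + (?g * t powr (- s) / \<delta>) *\<^sub>R A (x t - xs)"
      unfolding A.add A.scaleR scaleR_add_right using \<delta>_pos t0 by (simp add: powr_minus)
    finally show ?thesis by simp
  qed
  ultimately show ?thesis by (simp add: Z'_def algebra_simps)
qed

text \<open>The last summand of the energy gives the first rate. For the second, the bounds on
  \<open>l - ls\<close> and \<open>l1\<close> make \<open>Z'\<close> integrable, so \<open>Z\<close>
  is bounded, and the correction separating \<open>Z\<close> from \<open>g A (x - xs)\<close> is
  bounded too.\<close>

lemma convergence_rates:
  assumes H: "\<And>t. t > T \<Longrightarrow> (H has_real_derivative t powr (\<tau> / 2) * norm (e t)) (at t)"
    and H_le: "\<And>t. t > T \<Longrightarrow> H t \<le> M"
  shows "\<exists>C. \<forall>\<^sub>F t in at_top. exp_rate \<delta> s t * F (x t) \<le> C"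
    and "\<exists>C. \<forall>\<^sub>F t in at_top. exp_rate \<delta> s t * norm (A (x t - xs)) \<le> C"
proof -
  obtain c C where "0 < c" and ev: "\<forall>\<^sub>F t in at_top. c * t powr (- 2 * q) \<le> P t \<and> energy t \<le> C"
    using energy_bounded[OF H H_le] by blast
  \<comment> \<open>\<open>K\<close> comes from the \<open>P\<close>-weighted summand of the energy;
    \<open>L\<close> comes from writing \<open>\<gamma> l1\<close> as \<open>w\<close> minus
    \<open>l - ls\<close>, with the bound \<open>sqrt (2 * C)\<close> on the weighted norm of
    \<open>w\<close>.\<close>
  define K where "K = sqrt (2 * C / c)"
  define L where "L = (sqrt (2 * C) + K) / \<delta>"
  have bounds: "\<forall>\<^sub>F t in at_top. \<delta>\<^sup>2 * \<mu> * exp_rate \<delta> s t * F (x t) \<le> C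
     \<and> norm (l t - ls) \<le> K * t powr q \<and> norm (l1 t) \<le> L * t powr (- \<tau> / 2)"
    using ev eventually_gt_at_top[of "max T 1"]
  proof eventually_elim
    case (elim t)
    then have t: "t > 0" "t > 1" by auto
    have "0 \<le> c * t powr (- 2 * q)" using \<open>0 < c\<close> by simp
    with elim have P: "0 \<le> P t" by simp
    let ?a = "t powr (\<tau> - 2 * s) / 2 * (v t \<bullet> v t)" and ?b = "t powr (\<tau> - 2 * s) / 2 * (w t \<bullet> w t)"
      and ?c = "P t / 2 * ((x t - xs) \<bullet> (x t - xs))" and ?d = "P t / 2 * ((l t - ls) \<bullet> (l t - ls))"
      and ?e = "\<delta>\<^sup>2 * \<mu> * exp_rate \<delta> s t * F (x t)"
    have "energy t = ?a + ?b + ?c + ?d + ?e"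
      by (simp add: energy_def distrib_left)
    moreover have "0 \<le> ?a" "0 \<le> ?b" "0 \<le> ?c" "0 \<le> ?d" "0 \<le> ?e"
      using P \<mu>_pos F_nonneg by (auto simp: less_imp_le)
    ultimately have le: "?b \<le> C" "?d \<le> C" "?e \<le> C" using elim by linarith+
    have z: "norm (l t - ls) \<le> K * t powr q"
    proof -
      have "c * t powr (- 2 * q) * ((l t - ls) \<bullet> (l t - ls)) \<le> P t * ((l t - ls) \<bullet> (l t - ls))"
        using elim by (intro mult_right_mono) auto
      with le(2) have "c * t powr (- 2 * q) * (norm (l t - ls))\<^sup>2 \<le> 2 * C"
        by (simp add: power2_norm_eq_inner)
      moreover have "t powr (- 2 * q) * (norm (l t - ls))\<^sup>2 = (t powr (- q) * norm (l t - ls))\<^sup>2"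
        by (simp add: power_mult_distrib powr_square)
      ultimately have "(t powr (- q) * norm (l t - ls))\<^sup>2 \<le> 2 * C / c"
        using \<open>0 < c\<close> by (simp add: pos_le_divide_eq mult_ac)
      then have "t powr (- q) * norm (l t - ls) \<le> K" unfolding K_def by (rule real_le_rsqrt)
      then show ?thesis using t by (simp add: powr_minus field_simps)
    qed
    have w: "norm (w t) \<le> sqrt (2 * C) * t powr (s - \<tau> / 2)"
    proof -
      have "(t powr (\<tau> / 2 - s) * norm (w t))\<^sup>2 = t powr (\<tau> - 2 * s) * (w t \<bullet> w t)"
        by (simp add: power_mult_distrib power2_norm_eq_inner powr_square right_diff_distrib)
      with le(1) have "t powr (\<tau> / 2 - s) * norm (w t) \<le> sqrt (2 * C)"
        by (intro real_le_rsqrt) simp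
      then have "t powr (s - \<tau> / 2) * (t powr (\<tau> / 2 - s) * norm (w t)) \<le> t powr (s - \<tau> / 2) * sqrt (2 * C)"
        by (intro mult_left_mono) auto
      moreover have "t powr (s - \<tau> / 2) * (t powr (\<tau> / 2 - s) * norm (w t)) = norm (w t)"
        using t by (simp add: mult.assoc[symmetric] flip: powr_add)
      ultimately show ?thesis by (simp only: mult_ac)
    qed
    have "0 \<le> K"
      using z norm_ge_zero[of "l t - ls"] t by (smt (verit) mult_neg_pos powr_gt_zero)
    have "norm ((\<delta> * t powr s) *\<^sub>R l1 t) \<le> norm (w t) + norm (l t - ls)"
      using norm_triangle_ineq4[of "w t" "l t - ls"] by (simp add: w_def)
    also have "\<dots> \<le> sqrt (2 * C) * t powr (s - \<tau> / 2) + K * t powr (s - \<tau> / 2)"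
    proof -
      \<comment> \<open>Since \<open>r \<le> s\<close>, the exponent \<open>q\<close> is at most
        \<open>s - \<tau> / 2\<close>; powers are monotone in the exponent because
        \<open>t > 1\<close>.\<close>
      have "t powr q \<le> t powr (s - \<tau> / 2)"
        using t r_le by (intro powr_mono) (auto simp: q_def field_simps)
      then have "K * t powr q \<le> K * t powr (s - \<tau> / 2)"
        using \<open>0 \<le> K\<close> by (rule mult_left_mono)
      with z w show ?thesis by linarith
    qed
    also have "\<dots> = (L * t powr (- \<tau> / 2)) * (\<delta> * t powr s)"
    proof -
      have "t powr (s - \<tau> / 2) = t powr (- \<tau> / 2) * t powr s" by (simp flip: powr_add)
      then show ?thesis using \<delta>_pos by (simp add: L_def field_simps)
    qed
    finally have "norm (l1 t) * (\<delta> * t powr s) \<le> (L * t powr (- \<tau> / 2)) * (\<delta> * t powr s)"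
      using \<delta>_pos by (simp add: mult_ac)
    then have "norm (l1 t) \<le> L * t powr (- \<tau> / 2)"
      by (rule mult_right_le_imp_le) (use \<delta>_pos t in simp)
    with le z show ?case by blast
  qed
  show "\<exists>C. \<forall>\<^sub>F t in at_top. exp_rate \<delta> s t * F (x t) \<le> C"
  proof -
    have "\<forall>\<^sub>F t in at_top. exp_rate \<delta> s t * F (x t) \<le> C / (\<delta>\<^sup>2 * \<mu>)"
      using bounds by eventually_elim (use \<delta>_pos \<mu>_pos in \<open>simp add: field_simps\<close>)
    then show ?thesis by blast
  qed

  \<comment> \<open>Rate for the constraint residual\<close>
  obtain S where S: "\<And>t. t \<ge> S \<Longrightarrow> norm (l t - ls) \<le> K * t powr q \<and> norm (l1 t) \<le> L * t powr (- \<tau> / 2)"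
    using bounds unfolding eventually_at_top_linorder by blast
  define R where "R = max S (max T 1)"
  have R: "t > T" "t > 1" "norm (l t - ls) \<le> K * t powr q" "norm (l1 t) \<le> L * t powr (- \<tau> / 2)"
    if "t > R" for t
    using S[of t] that by (auto simp: R_def)
  have K: "0 \<le> K" and L: "0 \<le> L"
    using R(2-4)[of "R + 1"] norm_ge_zero[of "l (R + 1) - ls"] norm_ge_zero[of "l1 (R + 1)"]
    by (smt (verit) mult_neg_pos powr_gt_zero)+
  \<comment> \<open>The exponents on the left add up to \<open>\<tau> / 2 - s\<close>, which is at
    most \<open>- q\<close> because \<open>r \<le> s\<close>.\<close>
  have powers: "t powr (\<tau> - s) * t powr (- \<tau> / 2) \<le> t powr (- q)"
    if "t > 1" for t
    unfolding powr_add[symmetric] using that r_le by (intro powr_mono) (auto simp: q_def field_simps)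
  have powers': "t powr (- 2 * q) * t powr q = t powr (- q)" for t :: real
    by (simp flip: powr_add)
  obtain B where B: "\<And>t. t > R + 1 \<Longrightarrow> norm (Z t) \<le> B"
  proof -
    have "\<exists>B. \<forall>t>R+1. norm (Z t) \<le> B"
    proof (rule bounded_of_derivative_powr[OF Z_has_derivative[OF R(1)]])
      fix t assume t: "t > R"
      have "norm (Z' t) \<le> 1 / (\<delta> * \<mu>) * (\<bar>\<tau> - s\<bar> * t powr (\<tau> - s - 1) * norm (l1 t)
          + \<alpha> * (2 * q) * t powr (- 2 * q - 1) * norm (l t - ls))"
      proof -
        have "norm (Z' t) = 1 / (\<delta> * \<mu>) * norm (((\<tau> - s) * t powr (\<tau> - s - 1)) *\<^sub>R l1 t
             + (\<alpha> * (- 2 * q) * t powr (- 2 * q - 1)) *\<^sub>R (l t - ls))"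
          using \<delta>_pos \<mu>_pos by (simp add: Z'_def)
        also have "\<dots> \<le> 1 / (\<delta> * \<mu>) * (\<bar>\<tau> - s\<bar> * t powr (\<tau> - s - 1) * norm (l1 t)
          + \<alpha> * (2 * q) * t powr (- 2 * q - 1) * norm (l t - ls))"
          using \<delta>_pos \<mu>_pos \<alpha>_pos q_pos
          by (intro mult_left_mono norm_triangle_le) (auto simp: abs_mult)
        finally show ?thesis .
      qed
      \<comment> \<open>Both summands of \<open>Z'\<close> decay like
        \<open>t powr (- 1 - q)\<close>: the growth of \<open>l - ls\<close> costs only one of the
        two factors \<open>t powr (- q)\<close> in its coefficient.\<close>
      also have "\<dots> \<le> 1 / (\<delta> * \<mu>) * (\<bar>\<tau> - s\<bar> * (L * t powr (- 1 - q)) + \<alpha> * (2 * q) * (K * t powr (- 1 - q)))"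
      proof (intro mult_left_mono add_mono)
        have "t powr (\<tau> - s - 1) * norm (l1 t) \<le> t powr (\<tau> - s - 1) * (L * t powr (- \<tau> / 2))"
          using R(4)[OF t] by (intro mult_left_mono) auto
        also have "\<dots> = L * t powr (- 1) * (t powr (\<tau> - s) * t powr (- \<tau> / 2))"
        proof -
          have "t powr (\<tau> - s - 1) = t powr (- 1) * t powr (\<tau> - s)"
            unfolding powr_add[symmetric] by (simp add: algebra_simps)
          then show ?thesis by (simp only: mult_ac)
        qed
        also have "\<dots> \<le> L * t powr (- 1) * t powr (- q)"
          using powers[OF R(2)[OF t]] L by (intro mult_left_mono) auto
        also have "\<dots> = L * t powr (- 1 - q)"
          by (simp only: mult.assoc powr_add[symmetric] diff_conv_add_uminus)
        finally show "\<bar>\<tau> - s\<bar> * t powr (\<tau> - s - 1) * norm (l1 t) \<le> \<bar>\<tau> - s\<bar> * (L * t powr (- 1 - q))"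
          by (simp add: mult.assoc mult_left_mono)
        have "t powr (- 2 * q - 1) * norm (l t - ls) \<le> t powr (- 2 * q - 1) * (K * t powr q)"
          using R(3)[OF t] by (intro mult_left_mono) auto
        also have "\<dots> = K * t powr (- 1 - q)"
          by (simp add: mult_ac minus_diff_commute[of q] flip: powr_add)
        finally show "\<alpha> * (2 * q) * t powr (- 2 * q - 1) * norm (l t - ls) \<le> \<alpha> * (2 * q) * (K * t powr (- 1 - q))"
          using \<alpha>_pos q_pos by (simp add: mult.assoc mult_left_mono)
      qed (use \<delta>_pos \<mu>_pos in auto)
      also have "\<dots> = 1 / (\<delta> * \<mu>) * (\<bar>\<tau> - s\<bar> * L + \<alpha> * (2 * q) * K) * t powr (- 1 - q)"
        by (simp add: algebra_simps)
      finally show "norm (Z' t) \<le> 1 / (\<delta> * \<mu>) * (\<bar>\<tau> - s\<bar> * L + \<alpha> * (2 * q) * K) * t powr (- 1 - q)" .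
    qed (use q_pos in \<open>auto simp: R_def\<close>)
    then show ?thesis using that by blast
  qed
  have "exp_rate \<delta> s t * norm (A (x t - xs)) \<le> B + 1 / (\<delta> * \<mu>) * (L + \<alpha> * K)" if "t > R + 1" for t
  proof -
    have t: "t > R" "t > 1" using that R(2) by auto
    have small: "t powr (- q) \<le> 1" using powr_mono[of "- q" 0 t] t q_pos by simp
    have "t powr (\<tau> - s) * norm (l1 t) \<le> L"
    proof -
      have "t powr (\<tau> - s) * norm (l1 t) \<le> t powr (\<tau> - s) * (L * t powr (- \<tau> / 2))"
        using R(4)[OF t(1)] by (intro mult_left_mono) auto
      also have "\<dots> = L * (t powr (\<tau> - s) * t powr (- \<tau> / 2))" by simp
      also have "\<dots> \<le> L * 1"
        using powers[OF t(2)] small L by (intro mult_left_mono) auto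
      finally show ?thesis by simp
    qed
    moreover have "t powr (- 2 * q) * norm (l t - ls) \<le> K"
    proof -
      have "t powr (- 2 * q) * norm (l t - ls) \<le> t powr (- 2 * q) * (K * t powr q)"
        using R(3)[OF t(1)] by (intro mult_left_mono) auto
      also have "\<dots> = K * (t powr (- 2 * q) * t powr q)" by simp
      also have "\<dots> \<le> K * 1"
        using powers'[of t] small K by (intro mult_left_mono) auto
      finally show ?thesis by simp
    qed
    then have "\<alpha> * (t powr (- 2 * q) * norm (l t - ls)) \<le> \<alpha> * K"
      using \<alpha>_pos by (intro mult_left_mono) auto
    moreover have "norm (t powr (\<tau> - s) *\<^sub>R l1 t + (\<alpha> * t powr (- 2 * q)) *\<^sub>R (l t - ls))
      \<le> t powr (\<tau> - s) * norm (l1 t) + \<alpha> * (t powr (- 2 * q) * norm (l t - ls))"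
      using \<alpha>_pos by (intro norm_triangle_le) simp
    ultimately have "norm (t powr (\<tau> - s) *\<^sub>R l1 t + (\<alpha> * t powr (- 2 * q)) *\<^sub>R (l t - ls)) \<le> L + \<alpha> * K"
      by linarith
    then have "norm ((1 / (\<delta> * \<mu>)) *\<^sub>R (t powr (\<tau> - s) *\<^sub>R l1 t + (\<alpha> * t powr (- 2 * q)) *\<^sub>R (l t - ls)))
      \<le> 1 / (\<delta> * \<mu>) * (L + \<alpha> * K)"
      using \<delta>_pos \<mu>_pos by (simp add: divide_right_mono)
    moreover have "exp_rate \<delta> s t *\<^sub>R A (x t - xs) = Z t
      + (1 / (\<delta> * \<mu>)) *\<^sub>R (t powr (\<tau> - s) *\<^sub>R l1 t + (\<alpha> * t powr (- 2 * q)) *\<^sub>R (l t - ls))"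
      by (simp add: Z_def)
    then have "exp_rate \<delta> s t * norm (A (x t - xs)) = norm (Z t
      + (1 / (\<delta> * \<mu>)) *\<^sub>R (t powr (\<tau> - s) *\<^sub>R l1 t + (\<alpha> * t powr (- 2 * q)) *\<^sub>R (l t - ls)))"
      by (metis abs_of_pos exp_rate_pos norm_scaleR)
    ultimately show ?thesis
      using B[OF that] norm_triangle_ineq[of "Z t"] by (smt (verit))
  qed
  then show "\<exists>C. \<forall>\<^sub>F t in at_top. exp_rate \<delta> s t * norm (A (x t - xs)) \<le> C"
    using eventually_gt_at_top[of "R + 1"] by (blast intro: eventually_mono)
qed

end

subsection \<open>Solution curves\<close>

text \<open>A point \<open>t > a\<close> is interior to the half-line, so the relative derivative is
  the ordinary one.\<close>

lemma C2_on_has_vector_derivative: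
  assumes "C2_on {a..} u" "t > a"
  shows "(u has_vector_derivative deriv_on {a..} u t) (at t)"
    and "(deriv_on {a..} u has_vector_derivative deriv_on {a..} (deriv_on {a..} u) t) (at t)"
proof -
  have at: "at t within {a..} = at t"
    using assms(2) by (intro at_within_interior) simp
  have "(w has_vector_derivative deriv_on {a..} w t) (at t)"
    if "w differentiable_on {a..}" for w :: "real \<Rightarrow> 'a"
  proof -
    have "w differentiable (at t within {a..})"
      using that assms(2) by (auto simp: differentiable_on_def)
    then show ?thesis unfolding vector_derivative_works deriv_on_def at .
  qed
  then show "(u has_vector_derivative deriv_on {a..} u t) (at t)"
    "(deriv_on {a..} u has_vector_derivative deriv_on {a..} (deriv_on {a..} u) t) (at t)"
    using assms(1) unfolding C2_on_def by blast+
qed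

lemma C2_on_continuous:
  assumes "C2_on S u"
  shows "continuous_on S u" "continuous_on S (deriv_on S u)"
    "continuous_on S (deriv_on S (deriv_on S u))"
  using assms by (auto simp: C2_on_def intro: differentiable_imp_continuous_on)

text \<open>This supplies the bounded primitive for the energy estimate: continuity of
  \<open>h\<close> makes the integral differentiable at every \<open>t > a\<close>, while the bound
  comes from the integrable \<open>k\<close>, which agrees with \<open>h\<close> almost
  everywhere.\<close>

lemma integral_AE_eq_integrable:
  fixes h k :: "real \<Rightarrow> real"
  assumes cont: "continuous_on {a..} h" and int: "set_integrable lebesgue {a..} k"
    and ae: "AE t in lebesgue. t \<ge> a \<longrightarrow> h t = k t" and nonneg: "\<And>t. 0 \<le> k t"
    and t: "t > a"
  shows "((\<lambda>t. integral {a..t} h) has_real_derivative h t) (at t)"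
    and "integral {a..t} h \<le> integral {a..} k"
proof -
  have "((\<lambda>t. integral {a..t} h) has_real_derivative h t) (at t within {a..t+1})"
    using t by (intro integral_has_real_derivative continuous_on_subset[OF cont]) auto
  moreover have "at t within {a..t+1} = at t"
    using t by (intro at_within_interior) simp
  ultimately show "((\<lambda>t. integral {a..t} h) has_real_derivative h t) (at t)" by simp
  obtain N where N: "N \<in> null_sets lebesgue" "{t. \<not> (t \<ge> a \<longrightarrow> h t = k t)} \<subseteq> N"
    using ae unfolding eventually_ae_filter by auto
  have "integral {a..t} h = integral {a..t} k"
    by (rule integral_spike[where S = N]) (use N negligible_iff_null_sets in auto)
  also have "\<dots> \<le> integral {a..} k"
  proof (rule integral_subset_le)
    show k: "k integrable_on {a..}"
      using int set_lebesgue_integral_eq_integral(1) by blast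
    show "k integrable_on {a..t}"
      by (rule integrable_on_subinterval[OF k]) auto
  qed (use nonneg in auto)
  finally show "integral {a..t} h \<le> integral {a..} k" .
qed

theorem theorem2p6:
  fixes f :: "'a::{real_inner, complete_space} \<Rightarrow> real"
    and A :: "'a \<Rightarrow> 'b::{real_inner, complete_space}"
    and b :: 'b
    and t0 \<alpha> \<delta> \<sigma> \<mu> r s \<tau> :: real
    and \<epsilon> :: "real \<Rightarrow> 'a"
    and x :: "real \<Rightarrow> 'a" and l :: "real \<Rightarrow> 'b"
    and xs :: 'a and ls :: 'b
  assumes "bounded_linear A"
    and "convex_on UNIV f"
    and "continuously_differentiable f"
    and "t0 > 0" and "\<alpha> > 0" and "\<delta> > 0" and "\<sigma> \<ge> 0" and "\<mu> > 0"
    and "0 < r" and "r < 1"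
    and "r \<le> s" and "s < 1"
    and "0 < \<tau>" and "\<tau> < r + s"
    and "s = r \<longrightarrow> \<alpha> * \<delta> > 1"
    and "set_integrable lebesgue {t0..} (\<lambda>t. t powr (\<tau> / 2) * norm (\<epsilon> t))"
    and "global_solution f A b \<alpha> \<delta> \<sigma> r s (scaling \<mu> \<delta> s \<tau>) \<epsilon> t0 x l"
    and "(xs, ls) \<in> saddle_points f A b"
  shows "(\<lambda>t. \<bar>f (x t) - f xs\<bar>) \<in> O[at_top](\<lambda>t. 1 / exp_rate \<delta> s t) \<and>
         (\<lambda>t. norm (A (x t) - b)) \<in> O[at_top](\<lambda>t. 1 / exp_rate \<delta> s t)"
proof -
  let ?x1 = "deriv_on {t0..} x" and ?l1 = "deriv_on {t0..} l"
  let ?x2 = "deriv_on {t0..} ?x1" and ?l2 = "deriv_on {t0..} ?l1"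
  let ?\<beta> = "scaling \<mu> \<delta> s \<tau>"
  interpret A: bounded_linear A by fact
  interpret At: bounded_linear "adjoint A" by (rule bounded_linear_adjoint[OF assms(1)])
  note grad = continuously_differentiable_gradient[OF assms(3)]
  have C2: "C2_on {t0..} x" "C2_on {t0..} l"
    and sol: "AE t in lebesgue. t \<ge> t0 \<longrightarrow>
        ?x2 t + (\<alpha> / t powr r) *\<^sub>R ?x1 t =
          - (?\<beta> t *\<^sub>R (gradient f (x t) + adjoint A (l t + (\<delta> * t powr s) *\<^sub>R ?l1 t)
               + \<sigma> *\<^sub>R adjoint A (A (x t) - b))) + \<epsilon> t \<and>
        ?l2 t + (\<alpha> / t powr r) *\<^sub>R ?l1 t = ?\<beta> t *\<^sub>R (A (x t + (\<delta> * t powr s) *\<^sub>R ?x1 t) - b)"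
    using assms(17) unfolding global_solution_def by blast+
  note cx = C2_on_continuous[OF C2(1)] and cl = C2_on_continuous[OF C2(2)]
  have Axs: "A xs = b" by (rule saddle_points_feasible[OF assms(18)])
  have pos: "t powr a \<noteq> 0" if "t \<ge> t0" for t a using that assms(4) by simp
  have cp: "continuous_on {t0..} (\<lambda>t. t powr a)" for a
    using assms(4) by (auto intro!: continuous_intros)
  have c\<beta>: "continuous_on {t0..} ?\<beta>"
    unfolding scaling_def[abs_def] exp_rate_def
    using pos by (intro continuous_intros cp) auto
  have c\<alpha>: "continuous_on {t0..} (\<lambda>t. \<alpha> / t powr r)"
    using pos by (intro continuous_intros cp) auto

  \<comment> \<open>The perturbation agrees almost everywhere with the continuous function that satisfies the
    primal equation at every time.\<close>
  define e where "e t = ?x2 t + (\<alpha> / t powr r) *\<^sub>R ?x1 t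
      + ?\<beta> t *\<^sub>R (gradient f (x t) + adjoint A (l t + (\<delta> * t powr s) *\<^sub>R ?l1 t)
          + \<sigma> *\<^sub>R adjoint A (A (x t) - b))" for t
  have ce: "continuous_on {t0..} e"
    unfolding e_def[abs_def]
    by (intro continuous_intros c\<alpha> c\<beta> cp cx cl A.continuous_on At.continuous_on
        continuous_on_compose2[OF grad(2)]) auto
  have e_ae: "AE t in lebesgue. t \<ge> t0 \<longrightarrow> e t = \<epsilon> t"
    using sol by eventually_elim (auto simp: e_def)

  \<comment> \<open>The augmented Lagrangian gap relative to the saddle point. Its gradient
    \<open>G\<close> contains \<open>adjoint A ls\<close>, which is why the locale's primal equation
    has \<open>l - ls\<close> in place of \<open>l\<close>.\<close>
  define F where "F u = f u - f xs + ls \<bullet> (A u - b) + \<sigma> / 2 * ((A u - b) \<bullet> (A u - b))" for u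
  define G where "G u = gradient f u + adjoint A ls + \<sigma> *\<^sub>R adjoint A (A u - b)" for u
  have adj: "A u \<bullet> w = u \<bullet> adjoint A w" for u w by (rule inner_adjoint[OF assms(1)])

  interpret primal_dual_trajectory A "adjoint A" F G xs ls \<alpha> \<delta> \<mu> r s \<tau> t0 e x ?x1 ?x2 l ?l1 ?l2
  proof
    fix u
    have "lagrangian f A b xs ls \<le> lagrangian f A b u ls"
      using assms(18) by (auto simp: saddle_points_def)
    then show "0 \<le> F u"
      using assms(7) by (simp add: F_def lagrangian_def Axs)
    have d: "(A has_derivative A) (at u)" by (rule A.has_derivative) simp
    have "(F has_derivative (\<lambda>h. h \<bullet> gradient f u + ls \<bullet> A h
        + \<sigma> / 2 * ((A u - b) \<bullet> A h + A h \<bullet> (A u - b)))) (at u)"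
      unfolding F_def[abs_def]
      by (rule has_derivative_eq_rhs)
        (auto intro!: derivative_eq_intros d grad(1)[unfolded gderiv_def] simp: fun_eq_iff)
    then show "GDERIV F u :> G u" unfolding gderiv_def
      by (rule has_derivative_eq_rhs)
        (simp add: fun_eq_iff G_def inner_simps inner_commute adj[symmetric])
    \<comment> \<open>The difference of the two sides of \<open>F_le\<close> is the tangent gap of
      \<open>f\<close> plus half the penalty; both are nonnegative.\<close>
    have "G u \<bullet> (u - xs) = gradient f u \<bullet> (u - xs) + ls \<bullet> (A u - b) + \<sigma> * ((A u - b) \<bullet> (A u - b))"
    proof -
      have "adjoint A w \<bullet> (u - xs) = w \<bullet> (A u - b)" for w
        by (metis adj inner_commute A.diff Axs)
      then show ?thesis by (simp add: G_def inner_add_left)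
    qed
    moreover have "f xs - f u \<ge> gradient f u \<bullet> (xs - u)"
      by (rule convex_on_above_tangent_gderiv[OF assms(2) grad(1)])
    moreover have "0 \<le> \<sigma> * ((A u - b) \<bullet> (A u - b))" using assms(7) by simp
    ultimately show "F u \<le> G u \<bullet> (u - xs)"
      by (simp add: F_def inner_diff_right)
  next
    fix t assume t: "t > t0"
    show "(x has_vector_derivative ?x1 t) (at t)" "(?x1 has_vector_derivative ?x2 t) (at t)"
      "(l has_vector_derivative ?l1 t) (at t)" "(?l1 has_vector_derivative ?l2 t) (at t)"
      using C2_on_has_vector_derivative C2 t by blast+
    show "?x2 t + (\<alpha> / t powr r) *\<^sub>R ?x1 t =
      - (?\<beta> t *\<^sub>R (G (x t) + adjoint A (l t - ls + (\<delta> * t powr s) *\<^sub>R ?l1 t))) + e t"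
      by (simp add: e_def G_def At.add At.diff algebra_simps)
    \<comment> \<open>Both sides are continuous, so the almost-everywhere equation holds everywhere
      on the open half-line.\<close>
    have "?l2 t + (\<alpha> / t powr r) *\<^sub>R ?l1 t = ?\<beta> t *\<^sub>R (A (x t + (\<delta> * t powr s) *\<^sub>R ?x1 t) - b)"
    proof (rule AE_continuous_eq_everywhere[where S = "{t0<..}"])
      show "AE t in lebesgue. t \<in> {t0<..} \<longrightarrow> ?l2 t + (\<alpha> / t powr r) *\<^sub>R ?l1 t
          = ?\<beta> t *\<^sub>R (A (x t + (\<delta> * t powr s) *\<^sub>R ?x1 t) - b)"
        using sol by eventually_elim auto
      have "continuous_on {t0..} (\<lambda>t. ?l2 t + (\<alpha> / t powr r) *\<^sub>R ?l1 t)"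
        by (intro continuous_intros c\<alpha> cl)
      then show "continuous_on {t0<..} (\<lambda>t. ?l2 t + (\<alpha> / t powr r) *\<^sub>R ?l1 t)"
        by (rule continuous_on_subset) auto
      have "continuous_on {t0..} (\<lambda>t. ?\<beta> t *\<^sub>R (A (x t + (\<delta> * t powr s) *\<^sub>R ?x1 t) - b))"
        by (intro continuous_intros c\<beta> cp cx A.continuous_on)
      then show "continuous_on {t0<..} (\<lambda>t. ?\<beta> t *\<^sub>R (A (x t + (\<delta> * t powr s) *\<^sub>R ?x1 t) - b))"
        by (rule continuous_on_subset) auto
    qed (use t in auto)
    then show "?l2 t + (\<alpha> / t powr r) *\<^sub>R ?l1 t
      = ?\<beta> t *\<^sub>R A (x t - xs + (\<delta> * t powr s) *\<^sub>R ?x1 t)"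
      by (simp add: A.add A.diff Axs algebra_simps)
  qed (use assms adj in auto)

  \<comment> \<open>Integrability of the perturbation and transfer of the rates to
    \<open>f\<close>\<close>
  have ch: "continuous_on {t0..} (\<lambda>t. t powr (\<tau> / 2) * norm (e t))"
    by (intro continuous_intros cp ce)
  have h_ae: "AE t in lebesgue. t \<ge> t0 \<longrightarrow>
      t powr (\<tau> / 2) * norm (e t) = t powr (\<tau> / 2) * norm (\<epsilon> t)"
    using e_ae by eventually_elim auto
  note H = integral_AE_eq_integrable[OF ch assms(16) h_ae]
  have "\<exists>C. \<forall>\<^sub>F t in at_top. exp_rate \<delta> s t * F (x t) \<le> C"
    by (rule convergence_rates(1)[OF H]) auto
  then obtain C1 where C1: "\<forall>\<^sub>F t in at_top. exp_rate \<delta> s t * F (x t) \<le> C1" ..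
  have "\<exists>C. \<forall>\<^sub>F t in at_top. exp_rate \<delta> s t * norm (A (x t - xs)) \<le> C"
    by (rule convergence_rates(2)[OF H]) auto
  then obtain C2 where "\<forall>\<^sub>F t in at_top. exp_rate \<delta> s t * norm (A (x t - xs)) \<le> C2" ..
  then have C2: "\<forall>\<^sub>F t in at_top. exp_rate \<delta> s t * norm (A (x t) - b) \<le> C2"
    by (simp add: A.diff Axs)
  have "\<forall>\<^sub>F t in at_top. exp_rate \<delta> s t * \<bar>f (x t) - f xs\<bar> \<le> C1 + norm ls * C2 + \<sigma> / 2 * C2\<^sup>2"
    using C1 C2
  proof eventually_elim
    case (elim t)
    let ?g = "exp_rate \<delta> s t" and ?y = "A (x t) - b"
    \<comment> \<open>The exponent is nonnegative. This is what lets one factor \<open>?g\<close> be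
      replaced by two in the quadratic term, which is then bounded by the square of the residual
      bound.\<close>
    have g: "1 \<le> ?g" using assms(6,12) by (simp add: exp_rate_def)
    have "\<bar>f (x t) - f xs\<bar> \<le> F (x t) + \<bar>ls \<bullet> ?y\<bar> + \<sigma> / 2 * (?y \<bullet> ?y)"
    proof -
      have "0 \<le> \<sigma> / 2 * (?y \<bullet> ?y)" using assms(7) by simp
      then show ?thesis using F_nonneg[of "x t"] by (simp add: F_def)
    qed
    also have "\<dots> \<le> F (x t) + norm ls * norm ?y + \<sigma> / 2 * (norm ?y)\<^sup>2"
      using Cauchy_Schwarz_ineq2[of ls ?y] by (simp add: power2_norm_eq_inner)
    finally have "?g * \<bar>f (x t) - f xs\<bar> \<le> ?g * (F (x t) + norm ls * norm ?y + \<sigma> / 2 * (norm ?y)\<^sup>2)"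
      using g by (intro mult_left_mono) auto
    also have "\<dots> = ?g * F (x t) + norm ls * (?g * norm ?y) + \<sigma> / 2 * (?g * (norm ?y)\<^sup>2)"
      by (simp add: algebra_simps)
    also have "\<dots> \<le> C1 + norm ls * C2 + \<sigma> / 2 * C2\<^sup>2"
    proof (intro add_mono mult_left_mono)
      have "?g * (norm ?y)\<^sup>2 \<le> (?g * ?g) * (norm ?y)\<^sup>2"
        using g by (intro mult_right_mono) auto
      also have "\<dots> = (?g * norm ?y)\<^sup>2" by (simp add: power2_eq_square)
      also have "\<dots> \<le> C2\<^sup>2" using elim g by (intro power_mono) auto
      finally show "?g * (norm ?y)\<^sup>2 \<le> C2\<^sup>2" .
    qed (use elim assms(7) in auto)
    finally show ?case .
  qed
  moreover have "(\<lambda>t. u t) \<in> O[at_top](\<lambda>t. 1 / exp_rate \<delta> s t)"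
    if "\<forall>\<^sub>F t in at_top. exp_rate \<delta> s t * \<bar>u t\<bar> \<le> C" for u and C :: real
  proof (rule bigoI)
    show "\<forall>\<^sub>F t in at_top. norm (u t) \<le> C * norm (1 / exp_rate \<delta> s t)"
      using that by eventually_elim (simp add: field_simps less_imp_le abs_of_pos)
  qed
  ultimately show ?thesis using C2 by auto
qed

end
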